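(* Let $v:\{t_m\}_{m=0}^{M}\to H_h$ and $v_{kk}:\{t_m\}_{m=0}^{M-1}\to H_h$, $1\le k\le n$ (so that the boundary values of $v$ and of all $v_{kk}$ are zero), satisfy the scheme $$\rho\Lambda_t v^m-\big(\rho I+\tfrac1{12}h_t^2L_h\big)\tfrac1\rho\big(a_1^2v_{11}^m+\ldots+a_n^2v_{nn}^m\big)=f_{\mathbf h}^m\ \text{ on }\omega_h,\quad 1\le m\le M-1,$$ $$s_{kN}v_{kk}^m=\Lambda_kv^m+b_k^m\ \text{ on }\omega_h,\quad 0\le m\le M-1,\ 1\le k\le n,$$ $$\rho(\delta_tv)^0=\tfrac12h_t\big(\rho I+\tfrac1{12}h_t^2L_h\big)\tfrac1\rho\big(a_1^2v_{11}^0+\ldots+a_n^2v_{nn}^0\big)+u_{1\mathbf h}+\tfrac12h_tf_{\mathbf h}^0\ \text{ on }\omega_h,$$ with arbitrary functions $f_{\mathbf h},b_1,\ldots,b_n:\{t_m\}_{m=0}^{M-1}\to H_h$ and arbitrary $v^0,u_{1\mathbf h}\in H_h$. Assume the stability conditions $$\tfrac13h_t^2\Big(\tfrac{a_1^2}{h_1^2}+\ldots+\tfrac{a_n^2}{h_n^2}\Big)\le(1-\varepsilon)\underline{\rho}\ \text{ for some }0\le\varepsilon<1,\qquad \tfrac14h_t^2E_h\le(1-\varepsilon_0^2)\underline{\rho}\,I\ \text{ in }H_h\ \text{ for some }0<\varepsilon_0<1.$$ Then the following stability bounds hold: $$\max_{0\le m\le M}\max\big\{\varepsilon_0\|v^m\|_{E_h},\,\|I_{h_t}^m\bar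 s_tE_hv\|_{I_{\rho\mathbf h}}\big\}\le\|v^0\|_{E_h}+2\big\|\tfrac1\rho u_{1\mathbf h}\big\|_{I_{\rho\mathbf h}^{-1}}+2\big\|I_{\rho\mathbf h}^{-1/2}\big[\tfrac1\rho(f_{\mathbf h}+\beta_{\mathbf h})\big]\big\|_{\tilde L^1_{h_t}(H_h)},$$ $$\varepsilon_0\max_{1\le m\le M}\|\bar\delta_tv^m\|_{I_{\rho\mathbf h}^{-1}}\le(1+\varepsilon_0)\|v^0\|_{E_h}+(3+2\varepsilon_0)\Big(\big\|\tfrac1\rho u_{1\mathbf h}\big\|_{I_{\rho\mathbf h}^{-1}}+\big\|I_{\rho\mathbf h}^{-1/2}\big[\tfrac1\rho(f_{\mathbf h}+\beta_{\mathbf h})\big]\big\|_{\tilde L^1_{h_t}(H_h)}\Big),$$ where $$\beta_{\mathbf h}^m:=\big(\rho I+\tfrac1{12}h_t^2L_h\big)\tfrac1\rho\big(a_1^2s_{1N}^{-1}b_1^m+\ldots+a_n^2s_{nN}^{-1}b_n^m\big)\ \text{ in }H_h,\quad 0\le m\le M-1.$$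
   Context: Let $n\ge1$, $X_1,\ldots,X_n>0$, $\Omega=(0,X_1)\times\ldots\times(0,X_n)$, $T>0$; $a_1,\ldots,a_n>0$ are constants and $\rho$ is a function on $\bar\Omega$ with $0<\underline\rho\le\rho(x)\le\bar\rho$ for constants $\underline\rho,\bar\rho$. Time mesh: $t_m=mh_t$, $0\le m\le M$, $h_t=T/M$, $M\ge2$. For a function $y$ of the time level, $y^m=y(t_m)$, and $\bar s_ty^m=\frac12(y^{m-1}+y^m)$, $\bar\delta_ty^m=\frac{y^m-y^{m-1}}{h_t}$, $\delta_ty^m=\frac{y^{m+1}-y^m}{h_t}$, $\Lambda_ty^m=\frac{y^{m+1}-2y^m+y^{m-1}}{h_t^2}$; $I_{h_t}^my=h_t\sum_{l=1}^my^l$ for $1\le m\le M$, $I_{h_t}^0y=0$. In particular $I_{h_t}^m\bar s_tE_hv=h_t\sum_{l=1}^m\frac12E_h(v^{l-1}+v^l)$. Space mesh: in direction $x_k$ the nodes are $x_{ki}=ih_k$, $0\le i\le N_k$, $h_k=X_k/N_k$; $\bar\omega_h$ is the product of these one-dimensional meshes over $k=1,\ldots,n$, $\omega_h$ is its set of interior nodes ($1\le i_k\le N_k-1$ for all $k$), $\partial\omega_h=\bar\omega_h\setminus\omega_h$. $h=(h_1,\ldots,h_n)$, $\mathbf h=(h,h_t)$. $H_h$ is the space of real functions on $\bar\omega_h$ equal to $0$ on $\partial\omega_h$, with inner product $(v,w)_h=h_1\cdots h_n\sum_{x\in\omega_h}v(x)w(x)$ and norm $\|w\|_h=(w,w)_h^{1/2}$.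 $I$ is the identity; functions of $x$ such as $\rho$, $1/\rho$ act by pointwise multiplication. Operators below act in $H_h$ (their values are computed at nodes of $\omega_h$ and set to $0$ on $\partial\omega_h$), and operator inequalities are between self-adjoint operators in $H_h$. For $C=C^*>0$ in $H_h$, $\|w\|_C:=(Cw,w)_h^{1/2}$. Operators: acting in the $k$-th variable, $(\Lambda_kw)_i=\frac1{h_k^2}(w_{i+1}-2w_i+w_{i-1})$ and $s_{kN}w_i=\frac1{12}(w_{i-1}+10w_i+w_{i+1})$, i.e. $s_{kN}=I+\frac1{12}h_k^2\Lambda_k$ (it is self-adjoint and $\frac23I<s_{kN}<I$ in $H_h$). $L_h=a_1^2\Lambda_1+\ldots+a_n^2\Lambda_n$. The expression $(\rho I+\frac1{12}h_t^2L_h)\frac1\rho w$ means $w+\frac1{12}h_t^2L_h(w/\rho)$. Further $$E_h:=-(a_1^2s_{1N}^{-1}\Lambda_1+\ldots+a_n^2s_{nN}^{-1}\Lambda_n),\qquad I_{\rho\mathbf h}w:=\tfrac1\rho w+\tfrac1{12}h_t^2\,\tfrac1\rho L_h\big(\tfrac1\rho w\big).$$ Both are self-adjoint in $H_h$, $E_h>0$, and $I_{\rho\mathbf h}>0$ under the first stability condition of the claim. For functions $y:\{t_m\}_{m=0}^{M-1}\to H_h$: $\|y\|_{\tilde L^1_{h_t}(H_h)}:=\frac12h_t\|y^0\|_h+h_t\sum_{m=1}^{M-1}\|y^m\|_h$. *)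

theory Defs
  imports "HOL-Analysis.Analysis"
begin

(* The space dimension is CARD('n).  A node is given by its multi-index i (i k is its index in
   direction k), and a grid function is a real function of multi-indices.  The time level t_m is
   represented by m. *)

type_synonym 'n grid = "('n \<Rightarrow> nat) \<Rightarrow> real"

definition node :: "('n::finite \<Rightarrow> real) \<Rightarrow> ('n \<Rightarrow> nat) \<Rightarrow> real ^ 'n" where
  "node h i = (\<chi> k. real (i k) * h k)"

definition interior_nodes :: "('n \<Rightarrow> nat) \<Rightarrow> ('n \<Rightarrow> nat) set" where
  "interior_nodes N = {i. \<forall>k. 1 \<le> i k \<and> i k < N k}"

(* Functions on the closed mesh vanishing on its boundary, identified with their extension by 0
   to all multi-indices. *)
definition H_space :: "('n \<Rightarrow> nat) \<Rightarrow> 'n grid set" where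
  "H_space N = {w. \<forall>i. i \<notin> interior_nodes N \<longrightarrow> w i = 0}"

definition inner_h :: "('n::finite \<Rightarrow> nat) \<Rightarrow> ('n \<Rightarrow> real) \<Rightarrow> 'n grid \<Rightarrow> 'n grid \<Rightarrow> real" where
  "inner_h N h v w = (\<Prod>k\<in>UNIV. h k) * (\<Sum>i\<in>interior_nodes N. v i * w i)"

definition norm_h :: "('n::finite \<Rightarrow> nat) \<Rightarrow> ('n \<Rightarrow> real) \<Rightarrow> 'n grid \<Rightarrow> real" where
  "norm_h N h w = sqrt (inner_h N h w w)"

definition norm_op ::
  "('n::finite \<Rightarrow> nat) \<Rightarrow> ('n \<Rightarrow> real) \<Rightarrow> ('n grid \<Rightarrow> 'n grid) \<Rightarrow> 'n grid \<Rightarrow> real" where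
  "norm_op N h C w = sqrt (inner_h N h (C w) w)"

definition op_le ::
  "('n::finite \<Rightarrow> nat) \<Rightarrow> ('n \<Rightarrow> real) \<Rightarrow> ('n grid \<Rightarrow> 'n grid) \<Rightarrow> ('n grid \<Rightarrow> 'n grid) \<Rightarrow> bool" where
  "op_le N h A B \<longleftrightarrow> (\<forall>w\<in>H_space N. inner_h N h (A w) w \<le> inner_h N h (B w) w)"

definition op_inv :: "('n \<Rightarrow> nat) \<Rightarrow> ('n grid \<Rightarrow> 'n grid) \<Rightarrow> 'n grid \<Rightarrow> 'n grid" where
  "op_inv N C = inv_into (H_space N) C"

(* S is a nonnegative self-adjoint square root of C in H_h.  Linearity of S on H_h is implied by
   self-adjointness. *)
definition is_op_sqrt ::
  "('n::finite \<Rightarrow> nat) \<Rightarrow> ('n \<Rightarrow> real) \<Rightarrow> ('n grid \<Rightarrow> 'n grid) \<Rightarrow> ('n grid \<Rightarrow> 'n grid) \<Rightarrow> bool" where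
  "is_op_sqrt N h C S \<longleftrightarrow>
     (\<forall>w\<in>H_space N. S w \<in> H_space N) \<and>
     (\<forall>v\<in>H_space N. \<forall>w\<in>H_space N. inner_h N h (S v) w = inner_h N h v (S w)) \<and>
     (\<forall>w\<in>H_space N. 0 \<le> inner_h N h (S w) w) \<and>
     (\<forall>w\<in>H_space N. S (S w) = C w)"

(* For a nonnegative self-adjoint C such a square root exists and its values on H_h are unique,
   so the choice below affects only arguments outside H_h. *)
definition op_sqrt ::
  "('n::finite \<Rightarrow> nat) \<Rightarrow> ('n \<Rightarrow> real) \<Rightarrow> ('n grid \<Rightarrow> 'n grid) \<Rightarrow> 'n grid \<Rightarrow> 'n grid" where
  "op_sqrt N h C = (SOME S. is_op_sqrt N h C S)"

definition Lambda_k ::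
  "('n \<Rightarrow> nat) \<Rightarrow> ('n \<Rightarrow> real) \<Rightarrow> 'n \<Rightarrow> 'n grid \<Rightarrow> 'n grid" where
  "Lambda_k N h k w = (\<lambda>i. if i \<in> interior_nodes N
     then (w (i(k := i k + 1)) - 2 * w i + w (i(k := i k - 1))) / (h k)\<^sup>2 else 0)"

definition s_k :: "('n \<Rightarrow> nat) \<Rightarrow> 'n \<Rightarrow> 'n grid \<Rightarrow> 'n grid" where
  "s_k N k w = (\<lambda>i. if i \<in> interior_nodes N
     then (w (i(k := i k - 1)) + 10 * w i + w (i(k := i k + 1))) / 12 else 0)"

definition L_h ::
  "('n::finite \<Rightarrow> nat) \<Rightarrow> ('n \<Rightarrow> real) \<Rightarrow> ('n \<Rightarrow> real) \<Rightarrow> 'n grid \<Rightarrow> 'n grid" where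
  "L_h N h a w = (\<lambda>i. \<Sum>k\<in>UNIV. (a k)\<^sup>2 * Lambda_k N h k w i)"

definition E_h ::
  "('n::finite \<Rightarrow> nat) \<Rightarrow> ('n \<Rightarrow> real) \<Rightarrow> ('n \<Rightarrow> real) \<Rightarrow> 'n grid \<Rightarrow> 'n grid" where
  "E_h N h a w = (\<lambda>i. - (\<Sum>k\<in>UNIV. (a k)\<^sup>2 * op_inv N (s_k N k) (Lambda_k N h k w) i))"

(* In the following, r is the restriction of the coefficient rho to the nodes. *)

definition over :: "'n grid \<Rightarrow> 'n grid \<Rightarrow> 'n grid" where
  "over r w = (\<lambda>i. w i / r i)"

(* (rho I + 1/12 ht^2 L_h) (1/rho) w *)
definition rhoL ::
  "('n::finite \<Rightarrow> nat) \<Rightarrow> ('n \<Rightarrow> real) \<Rightarrow> real \<Rightarrow> ('n \<Rightarrow> real) \<Rightarrow> 'n grid \<Rightarrow> 'n grid \<Rightarrow> 'n grid" where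
  "rhoL N h ht a r w = (\<lambda>i. w i + ht\<^sup>2 / 12 * L_h N h a (over r w) i)"

definition I_rho ::
  "('n::finite \<Rightarrow> nat) \<Rightarrow> ('n \<Rightarrow> real) \<Rightarrow> real \<Rightarrow> ('n \<Rightarrow> real) \<Rightarrow> 'n grid \<Rightarrow> 'n grid \<Rightarrow> 'n grid" where
  "I_rho N h ht a r w = (\<lambda>i. over r w i + ht\<^sup>2 / 12 * over r (L_h N h a (over r w)) i)"

definition beta_h ::
  "('n::finite \<Rightarrow> nat) \<Rightarrow> ('n \<Rightarrow> real) \<Rightarrow> real \<Rightarrow> ('n \<Rightarrow> real) \<Rightarrow> 'n grid \<Rightarrow>
    ('n \<Rightarrow> nat \<Rightarrow> 'n grid) \<Rightarrow> nat \<Rightarrow> 'n grid" where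
  "beta_h N h ht a r b m =
     rhoL N h ht a r (\<lambda>i. \<Sum>k\<in>UNIV. (a k)\<^sup>2 * op_inv N (s_k N k) (b k m) i)"

definition sbar_t :: "(nat \<Rightarrow> 'n grid) \<Rightarrow> nat \<Rightarrow> 'n grid" where
  "sbar_t y m = (\<lambda>i. (y (m - 1) i + y m i) / 2)"

definition dbar_t :: "real \<Rightarrow> (nat \<Rightarrow> 'n grid) \<Rightarrow> nat \<Rightarrow> 'n grid" where
  "dbar_t ht y m = (\<lambda>i. (y m i - y (m - 1) i) / ht)"

definition d_t :: "real \<Rightarrow> (nat \<Rightarrow> 'n grid) \<Rightarrow> nat \<Rightarrow> 'n grid" where
  "d_t ht y m = (\<lambda>i. (y (m + 1) i - y m i) / ht)"

definition Lambda_t :: "real \<Rightarrow> (nat \<Rightarrow> 'n grid) \<Rightarrow> nat \<Rightarrow> 'n grid" where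
  "Lambda_t ht y m = (\<lambda>i. (y (m + 1) i - 2 * y m i + y (m - 1) i) / ht\<^sup>2)"

definition I_t :: "real \<Rightarrow> nat \<Rightarrow> (nat \<Rightarrow> 'n grid) \<Rightarrow> 'n grid" where
  "I_t ht m y = (\<lambda>i. ht * (\<Sum>l=1..m. y l i))"

definition norm_L1 ::
  "('n::finite \<Rightarrow> nat) \<Rightarrow> ('n \<Rightarrow> real) \<Rightarrow> real \<Rightarrow> nat \<Rightarrow> (nat \<Rightarrow> 'n grid) \<Rightarrow> real" where
  "norm_L1 N h ht M y = ht / 2 * norm_h N h (y 0) + ht * (\<Sum>m=1..M - 1. norm_h N h (y m))"

end

theory Submission
  imports Defs "HOL-Library.Function_Algebras"
begin

text \<open>
  Write \<open>\<tau>\<close> for the time step, \<open>E\<close> for \<open>E_h\<close>, \<open>G\<close> for \<open>I_\<rho>\<close> and \<open>F = (f + \<beta>) / \<rho>\<close>.  The averaging operators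
  \<open>s_k\<close> are invertible, so the auxiliary functions \<open>v_kk\<close> can be eliminated; after division by \<open>\<rho>\<close> the
  scheme is a three-level scheme \<open>\<Lambda>_t v + G E v = F\<close> with two self-adjoint operators
  \<open>E \<ge> 0\<close> and \<open>G > 0\<close>, started by half a step of the same equation.

  Summing over time turns it into a first-order system for \<open>v\<close> and the time integral
  \<open>w^m = I^m s_t E v\<close>:
  \<open>v^(m+1) - v^m = - \<tau> G (w^m + (\<tau>/2) E v^m - \<phi>^m)\<close>,
  \<open>w^(m+1) - w^m = (\<tau>/2) E (v^m + v^(m+1))\<close>,
  where \<open>\<phi>^m\<close> accumulates the data \<open>G^(-1) u\<close> and \<open>G^(-1) F\<close>.  As long as \<open>\<phi>\<close> is kept fixed, one step
  of this system preserves the quadratic form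
  \<open>(E v, v) - (\<tau>^2/4) (G E v, E v) + (G z, z)\<close> with \<open>z = w - \<phi>\<close>
  exactly.  The second stability condition makes this form at least
  \<open>\<epsilon>\<^sub>0^2 (E v, v) + (G z, z)\<close>, so that its square root is a seminorm, and changing \<open>\<phi>^(m-1)\<close> into
  \<open>\<phi>^m\<close> costs at most \<open>\<tau>\<close> times the norm of \<open>F^m\<close> by the triangle inequality.  Thus the energy seminorm
  never exceeds \<open>|v^0|_E\<close> plus the total norm of the data.  The bound for \<open>v\<close> is then immediate, the one
  for \<open>w\<close> follows from \<open>w = z + \<phi>\<close>, and the one for the difference quotient of \<open>v\<close> is read off from
  the first equation of the system.

  For the concrete operators, summation by parts shows that the second differences \<open>\<Lambda>_k\<close> are
  self-adjoint with \<open>- 4/h_k^2 < \<Lambda>_k \<le> 0\<close>.  Since \<open>s_k = I + (h_k^2/12) \<Lambda>_k\<close> commutes with \<open>\<Lambda>_k\<close> and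
  satisfies \<open>0 < s_k \<le> I\<close>, the operator \<open>E\<close> is nonnegative; the first stability condition gives
  \<open>G > 0\<close>; and \<open>G \<le> 1/\<rho>\<close> gives \<open>G^(-1) \<ge> \<rho>_lo\<close>, which converts the second stability condition
  into \<open>(\<tau>^2/4) E \<le> (1 - \<epsilon>\<^sub>0^2) G^(-1)\<close>.  The inverses and the square root of \<open>G^(-1)\<close> come from the
  spectral theorem on the finite-dimensional space of grid functions, obtained by maximizing the
  Rayleigh quotient.
\<close>

section \<open>Positive semidefinite forms and self-adjoint operators\<close>

text \<open>
  The difference operators are linear and symmetric only on grid functions vanishing at the boundary.
  Forms are therefore required to be bilinear and symmetric on a subspace \<open>H\<close> only, and are
  unconstrained outside it.
\<close>

locale psd_form =
  fixes H :: "'v::real_vector set" and q :: "'v \<Rightarrow> 'v \<Rightarrow> real"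
  assumes H: "subspace H"
    and add_left: "\<lbrakk>x \<in> H; y \<in> H; z \<in> H\<rbrakk> \<Longrightarrow> q (x + y) z = q x z + q y z"
    and scale_left: "\<lbrakk>x \<in> H; z \<in> H\<rbrakk> \<Longrightarrow> q (c *\<^sub>R x) z = c * q x z"
    and sym: "\<lbrakk>x \<in> H; y \<in> H\<rbrakk> \<Longrightarrow> q x y = q y x"
    and nonneg: "x \<in> H \<Longrightarrow> 0 \<le> q x x"
begin

lemma mem [simp]:
  "0 \<in> H" "\<lbrakk>x \<in> H; y \<in> H\<rbrakk> \<Longrightarrow> x + y \<in> H" "\<lbrakk>x \<in> H; y \<in> H\<rbrakk> \<Longrightarrow> x - y \<in> H"
  "x \<in> H \<Longrightarrow> c *\<^sub>R x \<in> H" "x \<in> H \<Longrightarrow> - x \<in> H"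
  using H by (auto simp: subspace_add subspace_diff subspace_scale subspace_0 subspace_neg)

lemma add_right: "\<lbrakk>x \<in> H; y \<in> H; z \<in> H\<rbrakk> \<Longrightarrow> q z (x + y) = q z x + q z y"
  by (simp add: sym[of z] add_left)

lemma scale_right: "\<lbrakk>x \<in> H; z \<in> H\<rbrakk> \<Longrightarrow> q z (c *\<^sub>R x) = c * q z x"
  by (simp add: sym[of z] scale_left)

lemma minus_left: "\<lbrakk>x \<in> H; z \<in> H\<rbrakk> \<Longrightarrow> q (- x) z = - q x z"
  using scale_left[of x z "-1"] by simp

lemma minus_right: "\<lbrakk>x \<in> H; z \<in> H\<rbrakk> \<Longrightarrow> q z (- x) = - q z x"
  using scale_right[of x z "-1"] by simp

lemma diff_left: "\<lbrakk>x \<in> H; y \<in> H; z \<in> H\<rbrakk> \<Longrightarrow> q (x - y) z = q x z - q y z"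
  using add_left[of x "- y" z] by (simp add: minus_left)

lemma diff_right: "\<lbrakk>x \<in> H; y \<in> H; z \<in> H\<rbrakk> \<Longrightarrow> q z (x - y) = q z x - q z y"
  using add_right[of x "- y" z] by (simp add: minus_right)

lemma zero_left [simp]: "z \<in> H \<Longrightarrow> q 0 z = 0"
  using scale_left[of 0 z 0] by simp

lemma zero_right [simp]: "z \<in> H \<Longrightarrow> q z 0 = 0"
  using scale_right[of 0 z 0] by simp

lemmas bilinear = add_left add_right scale_left scale_right minus_left minus_right
  diff_left diff_right

lemma cauchy_schwarz:
  assumes x: "x \<in> H" and y: "y \<in> H"
  shows "(q x y)\<^sup>2 \<le> q x x * q y y"
proof -
  have quad: "0 \<le> s\<^sup>2 * q x x + 2 * s * t * q x y + t\<^sup>2 * q y y" for s t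
    using nonneg[of "s *\<^sub>R x + t *\<^sub>R y"] x y
    by (simp add: bilinear sym[of y x] power2_eq_square algebra_simps)
  show ?thesis
  proof (cases "q y y = 0")
    case True
    have "q x y = 0"
    proof (rule ccontr)
      \<comment> \<open>the polynomial is now affine in \<open>t\<close>, and this \<open>t\<close> gives it the value \<open>-1\<close>\<close>
      assume ne: "q x y \<noteq> 0"
      then show False
        using quad[of 1 "- (q x x + 1) / (2 * q x y)"] True by (simp add: field_simps)
    qed
    then show ?thesis using True by simp
  next
    case False
    then have pos: "0 < q y y" using nonneg[OF y] by simp
    \<comment> \<open>the quadratic polynomial at its minimizer, up to a positive factor\<close>
    have "0 \<le> q y y * (q x x * q y y - (q x y)\<^sup>2)"
      using quad[of "q y y" "- q x y"] by (simp add: power2_eq_square algebra_simps)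
    then show ?thesis using pos by (simp add: zero_le_mult_iff)
  qed
qed

definition nrm :: "'v \<Rightarrow> real" where "nrm x = sqrt (q x x)"

lemma nrm_nonneg [simp]: "x \<in> H \<Longrightarrow> 0 \<le> nrm x"
  by (simp add: nrm_def nonneg)

lemma nrm_sq: "x \<in> H \<Longrightarrow> (nrm x)\<^sup>2 = q x x"
  by (simp add: nrm_def nonneg)

lemma nrm_zero [simp]: "nrm 0 = 0"
  by (simp add: nrm_def)

lemma nrm_triangle:
  assumes x: "x \<in> H" and y: "y \<in> H"
  shows "nrm (x + y) \<le> nrm x + nrm y"
proof -
  have "q x y \<le> \<bar>q x y\<bar>" by simp
  also have "\<dots> \<le> nrm x * nrm y"
    using real_sqrt_le_mono[OF cauchy_schwarz[OF x y]]
    by (simp add: nrm_def real_sqrt_mult)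
  finally have "(nrm (x + y))\<^sup>2 \<le> (nrm x + nrm y)\<^sup>2"
    using x y by (simp add: power2_sum nrm_sq bilinear sym[of y x])
  then show ?thesis
    by (rule power2_le_imp_le) (use x y in simp)
qed

lemma nrm_scale: "x \<in> H \<Longrightarrow> nrm (c *\<^sub>R x) = \<bar>c\<bar> * nrm x"
  by (simp add: nrm_def bilinear real_sqrt_mult mult.assoc[symmetric])

lemma nrm_minus: "x \<in> H \<Longrightarrow> nrm (- x) = nrm x"
  by (simp add: nrm_def bilinear)

lemma nrm_diff: "\<lbrakk>x \<in> H; y \<in> H\<rbrakk> \<Longrightarrow> nrm (x - y) \<le> nrm x + nrm y"
  using nrm_triangle[of x "- y"] by (simp add: nrm_minus)

end

locale inner_on = psd_form +
  assumes definite: "\<lbrakk>x \<in> H; q x x = 0\<rbrakk> \<Longrightarrow> x = 0"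
begin

definition self_adjoint :: "('a \<Rightarrow> 'a) \<Rightarrow> bool" where
  "self_adjoint C \<longleftrightarrow> (\<forall>x\<in>H. C x \<in> H) \<and> (\<forall>x\<in>H. \<forall>y\<in>H. q (C x) y = q x (C y))"

definition positive :: "('a \<Rightarrow> 'a) \<Rightarrow> bool" where
  "positive C \<longleftrightarrow> self_adjoint C \<and> (\<forall>x\<in>H. 0 \<le> q (C x) x)"

lemma self_adjointD:
  "\<lbrakk>self_adjoint C; x \<in> H\<rbrakk> \<Longrightarrow> C x \<in> H"
  "\<lbrakk>self_adjoint C; x \<in> H; y \<in> H\<rbrakk> \<Longrightarrow> q (C x) y = q x (C y)"
  by (auto simp: self_adjoint_def)

lemma eqI: "\<lbrakk>x \<in> H; y \<in> H; \<And>z. z \<in> H \<Longrightarrow> q x z = q y z\<rbrakk> \<Longrightarrow> x = y"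
  using definite[of "x - y"] by (simp add: bilinear)

text \<open>
  Both sides have the same inner product with every vector, because the operator can be moved to the
  other argument.
\<close>

lemma self_adjoint_linear:
  assumes C: "self_adjoint C" and "x \<in> H"
  shows "y \<in> H \<Longrightarrow> C (x + y) = C x + C y" "y \<in> H \<Longrightarrow> C (x - y) = C x - C y"
    "C (c *\<^sub>R x) = c *\<^sub>R C x"
  using assms by (auto intro!: eqI simp: self_adjointD bilinear)

lemma psd_form_of_positive:
  assumes "positive C"
  shows "psd_form H (\<lambda>x. q (C x))"
proof
  have C: "self_adjoint C" and pos: "\<And>x. x \<in> H \<Longrightarrow> 0 \<le> q (C x) x"
    using assms by (auto simp: positive_def)
  show "subspace H" by (rule H)
  show "q (C (x + y)) z = q (C x) z + q (C y) z" if "x \<in> H" "y \<in> H" "z \<in> H" for x y z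
    using that C by (simp add: self_adjoint_linear self_adjointD(1) bilinear)
  show "q (C (c *\<^sub>R x)) z = c * q (C x) z" if "x \<in> H" "z \<in> H" for x z c
    using that C by (simp add: self_adjoint_linear self_adjointD(1) bilinear)
  show "q (C x) y = q (C y) x" if "x \<in> H" "y \<in> H" for x y
    using that C by (simp add: self_adjointD sym[of x])
  show "0 \<le> q (C x) x" if "x \<in> H" for x using pos that .
qed

text \<open>
  The operator inequality \<open>C\<^sup>2 \<le> c C\<close> for \<open>0 \<le> C \<le> c I\<close>.  It is the Cauchy-Schwarz inequality of the form
  \<open>(C x, y)\<close> for \<open>y = C x\<close>, where the factor \<open>(C y, y)\<close> is at most \<open>c (y, y)\<close>.
\<close>

lemma positive_bounded_sq:
  assumes C: "positive C" and le: "\<And>x. x \<in> H \<Longrightarrow> q (C x) x \<le> c * q x x" and x: "x \<in> H"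
  shows "q (C x) (C x) \<le> c * q (C x) x"
proof -
  interpret F: psd_form H "\<lambda>x. q (C x)" by (rule psd_form_of_positive[OF C])
  have Cx: "C x \<in> H" using C x by (simp add: positive_def self_adjointD)
  show ?thesis
  proof (cases "q (C x) (C x) = 0")
    case True
    then have "C x = 0" using definite Cx by blast
    then show ?thesis using x by simp
  next
    case False
    then have pos: "0 < q (C x) (C x)" using nonneg[OF Cx] by simp
    have "(q (C x) (C x))\<^sup>2 \<le> q (C x) x * q (C (C x)) (C x)"
      using F.cauchy_schwarz[OF x Cx] .
    also have "\<dots> \<le> q (C x) x * (c * q (C x) (C x))"
      using le[OF Cx] F.nonneg[OF x] by (rule mult_left_mono)
    finally have "q (C x) (C x) * q (C x) (C x) \<le> (c * q (C x) x) * q (C x) (C x)"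
      by (simp add: power2_eq_square algebra_simps)
    then show ?thesis using pos by simp
  qed
qed

end

section \<open>Stability of an abstract three-level scheme\<close>

text \<open>
  The scheme \<open>\<Lambda>_t v + G E v = F\<close> with initial value \<open>v 0\<close> and initial velocity \<open>u\<close>.  The starting equation
  is what the scheme gives for half a time step, hence the factor \<open>\<tau> / 2\<close>.  The operator \<open>Gi\<close> is the inverse
  of \<open>G\<close>, and \<open>cfl\<close> is a Courant-Friedrichs-Lewy condition.
\<close>

locale three_level_scheme = inner_on H q for H :: "'v::real_vector set" and q +
  fixes E G Gi :: "'v \<Rightarrow> 'v" and \<tau> \<epsilon> :: real
    and v F :: "nat \<Rightarrow> 'v" and u :: 'v and M :: nat
  assumes E: "positive E" and G: "positive G"
    and Gi_mem: "x \<in> H \<Longrightarrow> Gi x \<in> H"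
    and G_Gi: "x \<in> H \<Longrightarrow> G (Gi x) = x" and Gi_G: "x \<in> H \<Longrightarrow> Gi (G x) = x"
    and \<tau>: "0 < \<tau>" and \<epsilon>: "0 < \<epsilon>" "\<epsilon> < 1"
    and cfl: "x \<in> H \<Longrightarrow> \<tau>\<^sup>2 / 4 * q (E x) x \<le> (1 - \<epsilon>\<^sup>2) * q (Gi x) x"
    and v: "m \<le> M \<Longrightarrow> v m \<in> H" and F: "m < M \<Longrightarrow> F m \<in> H" and u: "u \<in> H"
    and start: "v 1 - v 0 = \<tau> *\<^sub>R (u + (\<tau> / 2) *\<^sub>R (F 0 - G (E (v 0))))"
    and step: "\<lbrakk>1 \<le> m; m < M\<rbrakk> \<Longrightarrow>
      v (Suc m) - v m = v m - v (m - 1) + \<tau>\<^sup>2 *\<^sub>R (F m - G (E (v m)))"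
    and M: "0 < M"
begin

lemma EG: "self_adjoint E" "self_adjoint G"
  using E G by (auto simp: positive_def)

lemma EG_mem [simp]: "x \<in> H \<Longrightarrow> E x \<in> H" "x \<in> H \<Longrightarrow> G x \<in> H"
  using EG by (auto simp: self_adjointD)

lemmas linE = self_adjoint_linear[OF EG(1)]
lemmas linG = self_adjoint_linear[OF EG(2)]

sublocale e: psd_form H "\<lambda>x. q (E x)"
  by (rule psd_form_of_positive[OF E])

sublocale g: psd_form H "\<lambda>x. q (G x)"
  by (rule psd_form_of_positive[OF G])

abbreviation dual_nrm :: "'v \<Rightarrow> real" where
  "dual_nrm x \<equiv> sqrt (q (Gi x) x)"

lemma nrm_Gi: "x \<in> H \<Longrightarrow> g.nrm (Gi x) = dual_nrm x"
  by (simp add: g.nrm_def G_Gi Gi_mem sym)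

lemma dual_nrm_G: "x \<in> H \<Longrightarrow> dual_nrm (G x) = g.nrm x"
  by (simp add: g.nrm_def Gi_G sym)

text \<open>
  The condition \<open>cfl\<close> bounds \<open>E\<close> by \<open>Gi\<close>; multiplication by \<open>E\<close> from both sides of the inverted inequality
  bounds \<open>E G E\<close> by \<open>E\<close>.  The proof avoids inverting \<open>E\<close>: it applies the Cauchy-Schwarz inequality of the
  form \<open>(E x, y)\<close> to \<open>z = G E x\<close> and \<open>x\<close>, for which \<open>(Gi z, z) = (E x, z) = (E z, x)\<close>.
\<close>

lemma GE_bound:
  assumes x: "x \<in> H"
  shows "\<tau>\<^sup>2 / 4 * q (G (E x)) (E x) \<le> (1 - \<epsilon>\<^sup>2) * q (E x) x"
proof -
  define z where "z = G (E x)"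
  have z: "z \<in> H" using x by (simp add: z_def)
  have zE: "q (E z) x = q z (E x)" using x z EG by (simp add: self_adjointD)
  have "\<tau>\<^sup>2 / 4 * (q z (E x))\<^sup>2 \<le> \<tau>\<^sup>2 / 4 * (q (E z) z * q (E x) x)"
    using e.cauchy_schwarz[OF z x] zE by (intro mult_left_mono) auto
  also have "\<dots> \<le> (1 - \<epsilon>\<^sup>2) * q z (E x) * q (E x) x"
    using mult_right_mono[OF cfl[OF z] e.nonneg[OF x]] x
    by (simp add: z_def Gi_G sym mult.assoc)
  finally have *: "(\<tau>\<^sup>2 / 4 * q z (E x)) * q z (E x) \<le> ((1 - \<epsilon>\<^sup>2) * q (E x) x) * q z (E x)"
    by (simp add: power2_eq_square algebra_simps)
  have "0 \<le> q z (E x)" using g.nonneg[of "E x"] x by (simp add: z_def)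
  moreover have "0 \<le> (1 - \<epsilon>\<^sup>2) * q (E x) x"
    using \<epsilon> e.nonneg[OF x] by (simp add: power_le_one)
  ultimately show ?thesis
    using * by (cases "q z (E x) = 0") (auto simp: z_def mult_le_cancel_right)
qed

text \<open>
  The conserved quantity.  Its first two terms belong to \<open>E - (\<tau>\<^sup>2 / 4) E G E\<close>, the correction of \<open>E\<close> that
  makes conservation exact in discrete time.
\<close>

definition energy :: "'v \<times> 'v \<Rightarrow> 'v \<times> 'v \<Rightarrow> real" where
  "energy X Y = q (E (fst X)) (fst Y) - \<tau>\<^sup>2 / 4 * q (G (E (fst X))) (E (fst Y))
     + q (G (snd X)) (snd Y)"

lemma energy_lower:
  assumes "x \<in> H"
  shows "\<epsilon>\<^sup>2 * q (E x) x + q (G z) z \<le> energy (x, z) (x, z)"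
  using GE_bound[OF assms] by (simp add: energy_def algebra_simps)

sublocale p: psd_form "H \<times> H" energy
proof
  show "subspace (H \<times> H)" by (intro subspace_Times H)
  show "energy (X + Y) Z = energy X Z + energy Y Z" if "X \<in> H \<times> H" "Y \<in> H \<times> H" "Z \<in> H \<times> H" for X Y Z
    using that by (auto simp: energy_def linE linG bilinear algebra_simps)
  show "energy (c *\<^sub>R X) Z = c * energy X Z" if "X \<in> H \<times> H" "Z \<in> H \<times> H" for X Z c
    using that by (auto simp: energy_def linE linG bilinear algebra_simps)
  show "energy X Y = energy Y X" if "X \<in> H \<times> H" "Y \<in> H \<times> H" for X Y
    using that e.sym[of "fst X" "fst Y"] g.sym[of "snd X" "snd Y"]
      g.sym[of "E (fst X)" "E (fst Y)"] by (auto simp: energy_def)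
  show "0 \<le> energy X X" if "X \<in> H \<times> H" for X
  proof -
    have "0 \<le> \<epsilon>\<^sup>2 * q (E (fst X)) (fst X) + q (G (snd X)) (snd X)"
      using that e.nonneg g.nonneg by (intro add_nonneg_nonneg mult_nonneg_nonneg) auto
    also have "\<dots> \<le> energy X X" using energy_lower[of "fst X" "snd X"] that by auto
    finally show ?thesis .
  qed
qed

lemma nrm_le_energy:
  assumes "x \<in> H" "z \<in> H"
  shows "\<epsilon> * e.nrm x \<le> p.nrm (x, z)" "g.nrm z \<le> p.nrm (x, z)"
proof -
  have "\<epsilon>\<^sup>2 * q (E x) x \<le> energy (x, z) (x, z)" "q (G z) z \<le> energy (x, z) (x, z)"
    using energy_lower[of x z] e.nonneg[of x] g.nonneg[of z] assms \<epsilon>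
    by (auto intro: order_trans[rotated])
  then have "sqrt (\<epsilon>\<^sup>2 * q (E x) x) \<le> p.nrm (x, z)" "g.nrm z \<le> p.nrm (x, z)"
    by (auto simp: p.nrm_def g.nrm_def)
  then show "\<epsilon> * e.nrm x \<le> p.nrm (x, z)" "g.nrm z \<le> p.nrm (x, z)"
    using \<epsilon> by (auto simp: real_sqrt_mult e.nrm_def)
qed

lemma energy_nrm_0: "z \<in> H \<Longrightarrow> p.nrm (0, z) = g.nrm z"
  using linE(3)[of 0 0] linG(3)[of 0 0]
  by (simp add: p.nrm_def g.nrm_def energy_def) 

lemma energy_nrm_le_e: "x \<in> H \<Longrightarrow> p.nrm (x, 0) \<le> e.nrm x"
  using g.nonneg[of "E x"] by (simp add: p.nrm_def e.nrm_def energy_def)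

text \<open>
  The time integral of \<open>E v\<close> by the trapezoidal rule.
\<close>

primrec w :: "nat \<Rightarrow> 'v" where
  "w 0 = 0"
| "w (Suc m) = w m + (\<tau> / 2) *\<^sub>R (E (v m) + E (v (Suc m)))"

text \<open>
  The accumulated data.  The weight \<open>\<tau> / 2\<close> of \<open>F 0\<close> comes from the half step of the starting equation.
\<close>

definition \<phi> :: "nat \<Rightarrow> 'v" where
  "\<phi> m = Gi (u + (\<tau> / 2) *\<^sub>R F 0) + \<tau> *\<^sub>R (\<Sum>l=1..m. Gi (F l))"

lemma \<phi>_simps: "\<phi> 0 = Gi (u + (\<tau> / 2) *\<^sub>R F 0)" "\<phi> (Suc m) = \<phi> m + \<tau> *\<^sub>R Gi (F (Suc m))"
  by (simp_all add: \<phi>_def scaleR_add_right algebra_simps)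

lemma w_mem [simp]: "m \<le> M \<Longrightarrow> w m \<in> H"
  by (induction m) (auto simp: v)

lemma F0 [simp]: "F 0 \<in> H" using F M by simp

lemma \<phi>_mem [simp]: "m < M \<Longrightarrow> \<phi> m \<in> H"
  by (induction m) (auto simp: \<phi>_simps Gi_mem F u)

text \<open>
  The scheme summed over the time levels.  The sum of \<open>E v\<close> over \<open>1, \<dots>, m\<close> together with half of \<open>E (v 0)\<close>
  is the trapezoidal sum plus the half weight missing at the level \<open>m\<close>.
\<close>

lemma first_order:
  "m < M \<Longrightarrow> v (Suc m) - v m = - \<tau> *\<^sub>R G (w m + (\<tau> / 2) *\<^sub>R E (v m) - \<phi> m)"
proof (induction m)
  case 0
  have [simp]: "v 0 \<in> H" using v by simp
  show ?case
    using start by (simp add: linG \<phi>_simps G_Gi Gi_mem u algebra_simps scaleR_add_right)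
next
  case (Suc m)
  have [simp]: "v m \<in> H" "v (Suc m) \<in> H" "w m \<in> H" "\<phi> m \<in> H" "F (Suc m) \<in> H" "Gi (F (Suc m)) \<in> H"
    using Suc.prems v F Gi_mem by auto
  have "v (Suc (Suc m)) - v (Suc m) = - \<tau> *\<^sub>R G (w m + (\<tau> / 2) *\<^sub>R E (v m) - \<phi> m)
      + \<tau>\<^sup>2 *\<^sub>R (F (Suc m) - G (E (v (Suc m))))"
    using step[of "Suc m"] Suc by simp
  also have "\<dots> = - \<tau> *\<^sub>R G (w (Suc m) + (\<tau> / 2) *\<^sub>R E (v (Suc m)) - \<phi> (Suc m))"
    by (simp add: linG \<phi>_simps G_Gi power2_eq_square algebra_simps scaleR_add_right
        flip: scaleR_add_left)
  finally show ?case .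
qed

text \<open>
  The first-order equation, symmetrized in the two time levels of the step; this form is the one that
  can be tested with the increment of \<open>w\<close>.
\<close>

lemma step_average:
  assumes m: "m < M"
  shows "G ((w m - \<phi> m) + (w (Suc m) - \<phi> m)) =
    (\<tau> / 2) *\<^sub>R G (E (v (Suc m) - v m)) - (2 / \<tau>) *\<^sub>R (v (Suc m) - v m)"
proof -
  have [simp]: "v m \<in> H" "v (Suc m) \<in> H" "w m \<in> H" "\<phi> m \<in> H" using m v by auto
  have halves: "(\<tau> / 2) *\<^sub>R x + ((\<tau> / 2) *\<^sub>R x + y) = \<tau> *\<^sub>R x + y" for x y :: 'v
    by (simp add: add.assoc[symmetric] flip: scaleR_add_left)
  show ?thesis
    using \<tau> by (subst (2) first_order[OF m])
      (simp add: linE linG algebra_simps scaleR_add_right scaleR_2 halves)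
qed

text \<open>
  The core of the stability argument.  By bilinearity the change of energy is the form evaluated at the
  increments and the sums of the two levels.  The increment of \<open>w\<close> is \<open>(\<tau> / 2) E\<close> applied to the sum of the
  two values of \<open>v\<close>, and \<open>G\<close> applied to the sum of the two values of \<open>w - \<phi>\<close> is expressed through the increment
  of \<open>v\<close> by the averaged equation; the two contributions cancel.
\<close>

lemma energy_preserved:
  assumes m: "m < M"
  shows "p.nrm (v (Suc m), w (Suc m) - \<phi> m) = p.nrm (v m, w m - \<phi> m)"
proof -
  define z z' where "z = w m - \<phi> m" and "z' = w (Suc m) - \<phi> m"
  define d s where "d = v (Suc m) - v m" and "s = v (Suc m) + v m"
  have V: "v m \<in> H" "v (Suc m) \<in> H" using m v by auto
  have [simp]: "z \<in> H" "z' \<in> H" "d \<in> H" "s \<in> H"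
    using m V w_mem[of m] w_mem[of "Suc m"] by (auto simp: z_def z'_def d_def s_def)
  have zz: "z' - z = (\<tau> / 2) *\<^sub>R E s"
    using V by (simp add: z_def z'_def s_def linE algebra_simps)
  have "energy (v (Suc m), z') (v (Suc m), z') - energy (v m, z) (v m, z)
      = energy (d, z' - z) (s, z' + z)"
    using V p.sym[of "(v m, z)" "(v (Suc m), z')"]
      p.add_right[of "(v (Suc m), z')" "(v m, z)" "(d, z' - z)"]
      p.diff_left[of "(v (Suc m), z')" "(v m, z)"]
    by (simp add: d_def s_def)
  also have "\<dots> = q (E d) s - \<tau>\<^sup>2 / 4 * q (G (E d)) (E s) + q (z' - z) (G (z + z'))"
    using EG by (simp add: energy_def self_adjointD add.commute)
  also have "G (z + z') = (\<tau> / 2) *\<^sub>R G (E d) - (2 / \<tau>) *\<^sub>R d"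
    using step_average[OF m] by (simp add: z_def z'_def d_def)
  also have "q (E d) s - \<tau>\<^sup>2 / 4 * q (G (E d)) (E s) + q (z' - z) \<dots> = 0"
    using \<tau> e.sym[of s d] sym[of "E s" "G (E d)"]
    by (simp add: zz bilinear power2_eq_square algebra_simps)
  finally show ?thesis by (simp add: p.nrm_def z_def z'_def)
qed

definition load :: "nat \<Rightarrow> real" where
  "load m = dual_nrm u + \<tau> / 2 * dual_nrm (F 0) + \<tau> * (\<Sum>l=1..m. dual_nrm (F l))"

lemma load_Suc: "load (Suc m) = load m + \<tau> * dual_nrm (F (Suc m))"
  by (simp add: load_def algebra_simps)

lemma dual_nrm_nonneg: "x \<in> H \<Longrightarrow> 0 \<le> dual_nrm x"
  by (metis nrm_Gi Gi_mem g.nrm_nonneg)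

lemma load_nonneg: "m < M \<Longrightarrow> 0 \<le> load m"
proof (induction m)
  case 0
  have "0 \<le> \<tau> / 2 * dual_nrm (F 0)"
    using \<tau> dual_nrm_nonneg[OF F0] by (intro mult_nonneg_nonneg) simp_all
  then show ?case using dual_nrm_nonneg[OF u] by (simp add: load_def)
next
  case (Suc m)
  have "0 \<le> \<tau> * dual_nrm (F (Suc m))"
    using \<tau> dual_nrm_nonneg F Suc.prems by (intro mult_nonneg_nonneg) simp_all
  then show ?case using Suc by (simp add: load_Suc)
qed

lemma load_mono: "\<lbrakk>m \<le> l; l < M\<rbrakk> \<Longrightarrow> load m \<le> load l"
proof (induction l rule: dec_induct)
  case (step l)
  have "0 \<le> \<tau> * dual_nrm (F (Suc l))"
    using step.prems \<tau> dual_nrm_nonneg[of "F (Suc l)"] F by simp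
  then show ?case using step by (simp add: load_Suc)
qed simp

lemma \<phi>_bound: "m < M \<Longrightarrow> g.nrm (\<phi> m) \<le> load m"
proof (induction m)
  case 0
  have Gi_lin: "Gi (u + (\<tau> / 2) *\<^sub>R F 0) = Gi u + (\<tau> / 2) *\<^sub>R Gi (F 0)"
    using Gi_G[of "Gi u + (\<tau> / 2) *\<^sub>R Gi (F 0)"] u Gi_mem by (simp add: linG G_Gi)
  show ?case
    using g.nrm_triangle[of "Gi u" "(\<tau> / 2) *\<^sub>R Gi (F 0)"] u \<tau> Gi_mem
    by (simp add: \<phi>_simps Gi_lin load_def g.nrm_scale nrm_Gi)
next
  case (Suc m)
  then show ?case
    using g.nrm_triangle[of "\<phi> m" "\<tau> *\<^sub>R Gi (F (Suc m))"] \<tau> Gi_mem F[of "Suc m"]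
    by (simp add: \<phi>_simps load_Suc g.nrm_scale nrm_Gi)
qed

text \<open>
  In every step the energy is preserved while \<open>\<phi>\<close> is fixed; the subsequent change of \<open>\<phi>\<close> alters only the
  second component, by a vector of norm \<open>\<tau> * dual_nrm (F (Suc m))\<close>.
\<close>

lemma energy_bound: "m < M \<Longrightarrow> p.nrm (v m, w m - \<phi> m) \<le> e.nrm (v 0) + load m"
proof (induction m)
  case 0
  have "v 0 \<in> H" "\<phi> 0 \<in> H" using v M by auto
  then show ?case
    using p.nrm_diff[of "(v 0, 0)" "(0, \<phi> 0)"] energy_nrm_le_e[of "v 0"] \<phi>_bound[OF M]
    by (simp add: energy_nrm_0)
next
  case (Suc m)
  have [simp]: "v (Suc m) \<in> H" "\<phi> m \<in> H" "w m \<in> H" "w (Suc m) \<in> H"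
    "F (Suc m) \<in> H" "Gi (F (Suc m)) \<in> H"
    using v Gi_mem F Suc.prems w_mem[of "Suc m"] by (auto simp del: w.simps)
  have "p.nrm (v (Suc m), w (Suc m) - \<phi> (Suc m))
      \<le> p.nrm (v (Suc m), w (Suc m) - \<phi> m) + p.nrm (0, \<tau> *\<^sub>R Gi (F (Suc m)))"
    using p.nrm_diff[of "(v (Suc m), w (Suc m) - \<phi> m)" "(0, \<tau> *\<^sub>R Gi (F (Suc m)))"]
    by (simp add: \<phi>_simps diff_diff_eq del: w.simps)
  also have "p.nrm (0, \<tau> *\<^sub>R Gi (F (Suc m))) = \<tau> * dual_nrm (F (Suc m))"
    using \<tau> by (simp add: energy_nrm_0 g.nrm_scale nrm_Gi)
  finally show ?case
    using Suc energy_preserved[of m] by (simp add: load_Suc del: w.simps)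
qed

lemma e_bound:
  assumes "m \<le> M"
  shows "\<epsilon> * e.nrm (v m) \<le> e.nrm (v 0) + load (M - 1)"
proof (cases m)
  case 0
  have "\<epsilon> * e.nrm (v 0) \<le> 1 * e.nrm (v 0)"
    using \<epsilon> v by (intro mult_right_mono) auto
  then show ?thesis using 0 load_nonneg[of "M - 1"] M by simp
next
  case (Suc k)
  then have "v m \<in> H" "w m - \<phi> k \<in> H" using assms v by (auto simp del: w.simps)
  then have "\<epsilon> * e.nrm (v m) \<le> p.nrm (v m, w m - \<phi> k)" by (rule nrm_le_energy)
  also have "\<dots> \<le> e.nrm (v 0) + load k"
    using energy_preserved[of k] energy_bound[of k] Suc assms by simp
  also have "\<dots> \<le> e.nrm (v 0) + load (M - 1)" using load_mono[of k "M - 1"] Suc assms by simp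
  finally show ?thesis .
qed

lemma w_bound:
  assumes "m \<le> M"
  shows "g.nrm (w m) \<le> e.nrm (v 0) + 2 * load (M - 1)"
proof (cases m)
  case 0
  then show ?thesis using load_nonneg[of "M - 1"] M v by simp
next
  case (Suc k)
  then have H: "v m \<in> H" "w m - \<phi> k \<in> H" "\<phi> k \<in> H" using assms v by (auto simp del: w.simps)
  have "g.nrm (w m) \<le> g.nrm (w m - \<phi> k) + g.nrm (\<phi> k)"
    using g.nrm_triangle[OF H(2,3)] by simp
  also have "\<dots> \<le> p.nrm (v m, w m - \<phi> k) + load k"
    using nrm_le_energy(2)[OF H(1,2)] \<phi>_bound[of k] Suc assms by simp
  also have "\<dots> \<le> e.nrm (v 0) + 2 * load k"
    using energy_preserved[of k] energy_bound[of k] Suc assms by simp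
  also have "\<dots> \<le> e.nrm (v 0) + 2 * load (M - 1)" using load_mono[of k "M - 1"] Suc assms by simp
  finally show ?thesis .
qed

text \<open>
  The averaged equation expresses the difference quotient as \<open>G\<close> applied to
  \<open>(\<tau> / 4) E d - (z + z') / 2\<close>.  The first part is controlled by the bound for \<open>E G E\<close>, and \<open>z\<close>, \<open>z'\<close> by the
  energy before and after the step.
\<close>

lemma increment_bound:
  assumes m: "m < M"
  shows "\<epsilon> * dual_nrm ((1 / \<tau>) *\<^sub>R (v (Suc m) - v m)) \<le> (1 + \<epsilon>) * (e.nrm (v 0) + load (M - 1))"
proof -
  define z z' where "z = w m - \<phi> m" and "z' = w (Suc m) - \<phi> m"
  define d where "d = v (Suc m) - v m"
  let ?R = "e.nrm (v 0) + load (M - 1)"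
  have V: "v m \<in> H" "v (Suc m) \<in> H" using m v by auto
  have [simp]: "z \<in> H" "z' \<in> H" "d \<in> H"
    using m V w_mem[of m] w_mem[of "Suc m"] by (auto simp: z_def z'_def d_def)
  have "(\<tau> / 4) *\<^sub>R G (E d) - (1 / 2) *\<^sub>R G (z + z') = (1 / \<tau>) *\<^sub>R d"
    using step_average[OF m] by (simp add: z_def z'_def d_def scaleR_diff_right)
  then have d_eq: "(1 / \<tau>) *\<^sub>R d = G ((\<tau> / 4) *\<^sub>R E d - (1 / 2) *\<^sub>R (z + z'))"
    by (simp add: linG)
  have Ed: "\<tau> / 4 * g.nrm (E d) \<le> e.nrm d / 2"
  proof -
    have "(\<tau> * g.nrm (E d))\<^sup>2 \<le> (2 * e.nrm d)\<^sup>2"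
      using GE_bound[of d] e.nonneg[of d] mult_right_mono[of "1 - \<epsilon>\<^sup>2" 1 "q (E d) d"]
      by (simp add: power_mult_distrib g.nrm_sq e.nrm_sq)
    then have "\<tau> * g.nrm (E d) \<le> 2 * e.nrm d" by (rule power2_le_imp_le) simp
    then show ?thesis by simp
  qed
  have "load m \<le> load (M - 1)" using m by (intro load_mono) auto
  then have zb: "g.nrm z \<le> ?R" "g.nrm z' \<le> ?R"
    using nrm_le_energy(2)[OF V(1), of z] nrm_le_energy(2)[OF V(2), of z']
      energy_bound[OF m] energy_preserved[OF m] m
    by (auto simp: z_def z'_def simp del: w.simps)
  have "dual_nrm ((1 / \<tau>) *\<^sub>R d) = g.nrm ((\<tau> / 4) *\<^sub>R E d - (1 / 2) *\<^sub>R (z + z'))"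
    by (simp add: d_eq dual_nrm_G)
  also have "\<dots> \<le> \<tau> / 4 * g.nrm (E d) + 1 / 2 * (g.nrm z + g.nrm z')"
  proof -
    have "g.nrm ((\<tau> / 4) *\<^sub>R E d - (1 / 2) *\<^sub>R (z + z')) \<le> \<tau> / 4 * g.nrm (E d) + 1 / 2 * g.nrm (z + z')"
      using g.nrm_diff[of "(\<tau> / 4) *\<^sub>R E d" "(1 / 2) *\<^sub>R (z + z')"] \<tau>
      by (simp add: g.nrm_scale)
    moreover have "g.nrm (z + z') \<le> g.nrm z + g.nrm z'"
      by (simp add: g.nrm_triangle)
    ultimately show ?thesis by argo
  qed
  also have "\<dots> \<le> (e.nrm (v (Suc m)) + e.nrm (v m)) / 2 + ?R"
    using Ed zb e.nrm_diff[OF V(2) V(1)] unfolding d_def by argo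
  finally have "\<epsilon> * dual_nrm ((1 / \<tau>) *\<^sub>R d)
      \<le> \<epsilon> * ((e.nrm (v (Suc m)) + e.nrm (v m)) / 2 + ?R)"
    using \<epsilon> by (simp add: mult_left_mono)
  also have "\<dots> \<le> (1 + \<epsilon>) * ?R"
    using e_bound[of m] e_bound[of "Suc m"] m by (simp add: algebra_simps)
  finally show ?thesis by (simp add: d_def)
qed

end

section \<open>Eigenvectors and functional calculus\<close>

context psd_form
begin

lemma sum_mem: "(\<And>e. e \<in> B \<Longrightarrow> f e \<in> H) \<Longrightarrow> sum f B \<in> H"
  using H by (rule subspace_sum)

lemma sum_left:
  assumes "\<And>e. e \<in> B \<Longrightarrow> f e \<in> H" and z: "z \<in> H"
  shows "q (sum f B) z = (\<Sum>e\<in>B. q (f e) z)"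
  using assms(1)
proof (induction B rule: infinite_finite_induct)
  case (insert e B)
  then show ?case using z sum_mem[of B f] by (simp add: bilinear)
qed (use z in simp_all)

lemma sum_right:
  assumes "\<And>e. e \<in> B \<Longrightarrow> f e \<in> H" and "z \<in> H"
  shows "q z (sum f B) = (\<Sum>e\<in>B. q z (f e))"
  using sum_left[OF assms] assms sum_mem[of B f] by (simp add: sym[of z])

end

context inner_on
begin

text \<open>
  If \<open>\<mu>\<close> is the maximum of the Rayleigh quotient on an invariant subspace, then \<open>\<mu> (x, y) - (C x, y)\<close> is a
  positive semidefinite form there.  It vanishes at a maximizer, which by the Cauchy-Schwarz inequality
  lies in its kernel.
\<close>

lemma maximizer_is_eigenvector:
  assumes C: "self_adjoint C" and V: "subspace V" "V \<subseteq> H" "C ` V \<subseteq> V"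
    and x: "x \<in> V" "q (C x) x = \<mu> * q x x" and max: "\<And>y. y \<in> V \<Longrightarrow> q (C y) y \<le> \<mu> * q y y"
  shows "C x = \<mu> *\<^sub>R x"
proof -
  have VH: "y \<in> H" "C y \<in> H" "C y \<in> V" if "y \<in> V" for y using V that by auto
  interpret D: psd_form V "\<lambda>x y. \<mu> * q x y - q (C x) y"
  proof
    show "subspace V" by (rule V)
    show "\<mu> * q (x + y) z - q (C (x + y)) z = \<mu> * q x z - q (C x) z + (\<mu> * q y z - q (C y) z)"
      if "x \<in> V" "y \<in> V" "z \<in> V" for x y z
      using that C by (simp add: VH bilinear self_adjoint_linear algebra_simps)
    show "\<mu> * q (c *\<^sub>R x) z - q (C (c *\<^sub>R x)) z = c * (\<mu> * q x z - q (C x) z)"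
      if "x \<in> V" "z \<in> V" for c x z
      using that C by (simp add: VH bilinear self_adjoint_linear algebra_simps)
    show "\<mu> * q x y - q (C x) y = \<mu> * q y x - q (C y) x" if "x \<in> V" "y \<in> V" for x y
      using that self_adjointD(2)[OF C, of x y] by (simp add: VH sym)
    show "0 \<le> \<mu> * q y y - q (C y) y" if "y \<in> V" for y using max[OF that] by simp
  qed
  let ?z = "\<mu> *\<^sub>R x - C x"
  have z: "?z \<in> V" using x VH by simp
  have "(q ?z ?z)\<^sup>2 \<le> 0"
    using D.cauchy_schwarz[OF x(1) z] x VH z by (simp add: bilinear sym[of x "C x"])
  then have "?z = 0" using definite[of ?z] VH z by simp
  then show ?thesis by simp
qed

definition orthonormal :: "'a set \<Rightarrow> bool" where
  "orthonormal B \<longleftrightarrow> finite B \<and> B \<subseteq> H \<and> (\<forall>d\<in>B. \<forall>e\<in>B. q d e = (if d = e then 1 else 0))"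

text \<open>
  The residual of the orthogonal projection onto the span of an orthonormal set has nonnegative square.
\<close>

lemma bessel:
  assumes B: "orthonormal B" and x: "x \<in> H"
  shows "(\<Sum>e\<in>B. (q x e)\<^sup>2) \<le> q x x"
proof -
  let ?y = "\<Sum>e\<in>B. q x e *\<^sub>R e"
  have BH: "e \<in> H" if "e \<in> B" for e using that B by (auto simp: orthonormal_def)
  have y: "?y \<in> H" by (intro sum_mem) (simp add: BH)
  have "q ?y e = q x e" if "e \<in> B" for e
  proof -
    have "q ?y e = (\<Sum>d\<in>B. q (q x d *\<^sub>R d) e)"
      using that by (intro sum_left) (simp_all add: BH)
    also have "\<dots> = (\<Sum>d\<in>B. if d = e then q x e else 0)"
      by (intro sum.cong refl) (use B that in \<open>simp add: BH scale_left orthonormal_def\<close>)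
    also have "\<dots> = q x e" using that B by (simp add: orthonormal_def)
    finally show ?thesis .
  qed
  moreover have sum: "q z ?y = (\<Sum>e\<in>B. q x e * q z e)" if "z \<in> H" for z
    using sum_right[of B "\<lambda>e. q x e *\<^sub>R e" z] that by (simp add: BH scale_right)
  ultimately have yy: "q ?y ?y = (\<Sum>e\<in>B. (q x e)\<^sup>2)"
    using y by (simp add: power2_eq_square)
  have xy: "q x ?y = (\<Sum>e\<in>B. (q x e)\<^sup>2)"
    using x by (simp add: sum power2_eq_square)
  show ?thesis
    using nonneg[of "x - ?y"] x y xy yy sym[OF y x] by (simp add: diff_left diff_right)
qed

definition eigenbasis :: "('a \<Rightarrow> 'a) \<Rightarrow> 'a set \<Rightarrow> bool" where
  "eigenbasis C B \<longleftrightarrow> orthonormal B \<and> (\<forall>e\<in>B. C e = q (C e) e *\<^sub>R e)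
     \<and> (\<forall>x\<in>H. (\<forall>e\<in>B. q x e = 0) \<longrightarrow> x = 0)"

text \<open>
  The operator \<open>f(C)\<close> of the functional calculus, given by applying \<open>f\<close> to the eigenvalues of \<open>C\<close>.  It is used for
  the inverse and for the square root.
\<close>

definition func_calc :: "('a \<Rightarrow> 'a) \<Rightarrow> 'a set \<Rightarrow> (real \<Rightarrow> real) \<Rightarrow> 'a \<Rightarrow> 'a" where
  "func_calc C B f x = (\<Sum>e\<in>B. (f (q (C e) e) * q x e) *\<^sub>R e)"

lemma eigenbasisD:
  assumes "eigenbasis C B"
  shows "finite B" "e \<in> B \<Longrightarrow> e \<in> H" "\<lbrakk>d \<in> B; e \<in> B\<rbrakk> \<Longrightarrow> q d e = (if d = e then 1 else 0)"
    "\<lbrakk>x \<in> H; \<And>e. e \<in> B \<Longrightarrow> q x e = 0\<rbrakk> \<Longrightarrow> x = 0"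
  using assms by (auto simp: eigenbasis_def orthonormal_def)

lemma eigenbasis_eigenvector: "\<lbrakk>eigenbasis C B; e \<in> B\<rbrakk> \<Longrightarrow> C e = q (C e) e *\<^sub>R e"
  by (simp add: eigenbasis_def)

lemma func_calc_mem: "eigenbasis C B \<Longrightarrow> func_calc C B f x \<in> H"
  unfolding func_calc_def by (intro sum_mem) (simp add: eigenbasisD)

lemma func_calc_coeff:
  assumes B: "eigenbasis C B" and e: "e \<in> B"
  shows "q (func_calc C B f x) e = f (q (C e) e) * q x e"
proof -
  have "q (func_calc C B f x) e = (\<Sum>d\<in>B. q ((f (q (C d) d) * q x d) *\<^sub>R d) e)"
    unfolding func_calc_def using e B by (intro sum_left) (simp_all add: eigenbasisD)
  also have "\<dots> = (\<Sum>d\<in>B. if d = e then f (q (C e) e) * q x e else 0)"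
    by (intro sum.cong refl) (use B e in \<open>simp add: eigenbasisD scale_left\<close>)
  also have "\<dots> = f (q (C e) e) * q x e"
    using e eigenbasisD(1)[OF B] by simp
  finally show ?thesis .
qed

lemma eigenbasis_eqI:
  assumes "eigenbasis C B" "x \<in> H" "y \<in> H" "\<And>e. e \<in> B \<Longrightarrow> q x e = q y e"
  shows "x = y"
  using eigenbasisD(4)[OF assms(1), of "x - y"] eigenbasisD(2)[OF assms(1)] assms(2-)
  by (simp add: bilinear)

lemma func_calc_id:
  assumes "eigenbasis C B" "self_adjoint C" "x \<in> H"
  shows "func_calc C B (\<lambda>t. t) x = C x"
proof (rule eigenbasis_eqI[OF assms(1)])
  fix e assume e: "e \<in> B"
  have "q (C x) e = q x (C e)" using assms e by (simp add: self_adjointD eigenbasisD)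
  also have "\<dots> = q (C e) e * q x e"
    by (subst eigenbasis_eigenvector[OF assms(1) e]) (use assms e in \<open>simp add: bilinear eigenbasisD\<close>)
  finally show "q (func_calc C B (\<lambda>t. t) x) e = q (C x) e"
    using assms(1) e by (simp add: func_calc_coeff)
qed (use assms in \<open>auto simp: self_adjointD func_calc_mem\<close>)

lemma func_calc_one:
  assumes "eigenbasis C B" "x \<in> H" "\<And>e. e \<in> B \<Longrightarrow> f (q (C e) e) = 1"
  shows "func_calc C B f x = x"
  using assms by (auto intro!: eigenbasis_eqI[OF assms(1)] simp: func_calc_coeff func_calc_mem)

lemma func_calc_comp:
  assumes "eigenbasis C B"
  shows "func_calc C B f (func_calc C B g x) = func_calc C B (\<lambda>t. f t * g t) x"
  using assms by (auto intro!: eigenbasis_eqI[OF assms] simp: func_calc_coeff func_calc_mem)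

lemma func_calc_inner:
  assumes "eigenbasis C B" "x \<in> H" "y \<in> H"
  shows "q (func_calc C B f x) y = (\<Sum>e\<in>B. f (q (C e) e) * q x e * q y e)"
proof -
  have "q (func_calc C B f x) y = (\<Sum>e\<in>B. q ((f (q (C e) e) * q x e) *\<^sub>R e) y)"
    unfolding func_calc_def using assms by (intro sum_left) (simp_all add: eigenbasisD)
  also have "\<dots> = (\<Sum>e\<in>B. f (q (C e) e) * q x e * q y e)"
    by (intro sum.cong refl) (use assms in \<open>simp add: eigenbasisD(2) scale_left sym[of y]\<close>)
  finally show ?thesis .
qed

lemma func_calc_positive:
  assumes B: "eigenbasis C B" and f: "\<And>e. e \<in> B \<Longrightarrow> 0 \<le> f (q (C e) e)"
  shows "positive (func_calc C B f)"
  unfolding positive_def self_adjoint_def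
proof (intro conjI ballI)
  show "func_calc C B f x \<in> H" for x by (rule func_calc_mem[OF B])
  show "q (func_calc C B f x) y = q x (func_calc C B f y)" if "x \<in> H" "y \<in> H" for x y
    using that B by (simp add: func_calc_inner sym[of x] func_calc_mem mult.assoc mult.commute[of "q x _"])
  show "0 \<le> q (func_calc C B f x) x" if "x \<in> H" for x
  proof -
    have "q (func_calc C B f x) x = (\<Sum>e\<in>B. f (q (C e) e) * (q x e)\<^sup>2)"
      using that B by (simp add: func_calc_inner power2_eq_square mult.assoc)
    also have "0 \<le> \<dots>" using f by (intro sum_nonneg mult_nonneg_nonneg) simp_all
    finally show ?thesis .
  qed
qed

definition positive_definite :: "('a \<Rightarrow> 'a) \<Rightarrow> bool" where
  "positive_definite C \<longleftrightarrow> self_adjoint C \<and> (\<forall>x\<in>H. x \<noteq> 0 \<longrightarrow> 0 < q (C x) x)"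

lemma positive_definite_positive: "positive_definite C \<Longrightarrow> positive C"
  unfolding positive_definite_def positive_def
  by (metis order.refl less_imp_le mem(1) self_adjointD(1) zero_right)

text \<open>
  The eigenvalues are nonzero, so the functional calculus for \<open>inverse\<close> provides preimages.
\<close>

lemma positive_definite_bij:
  assumes B: "eigenbasis C B" and C: "positive_definite C"
  shows "bij_betw C H H"
proof -
  have sa: "self_adjoint C" and pos: "\<And>x. \<lbrakk>x \<in> H; x \<noteq> 0\<rbrakk> \<Longrightarrow> 0 < q (C x) x"
    using C by (auto simp: positive_definite_def)
  have ev: "q (C e) e \<noteq> 0" if "e \<in> B" for e
  proof -
    have "e \<noteq> 0" using eigenbasisD(2,3)[OF B] that zero_right[of e] by force
    then show ?thesis using pos[of e] eigenbasisD(2)[OF B that] by simp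
  qed
  have "C (func_calc C B inverse x) = x" if "x \<in> H" for x
    using that B sa ev
    by (simp add: func_calc_comp func_calc_one func_calc_mem flip: func_calc_id)
  then have "H \<subseteq> C ` H" using B by (metis func_calc_mem image_iff subsetI)
  moreover have "C ` H \<subseteq> H" using sa by (auto simp: self_adjointD)
  moreover have "inj_on C H"
  proof (rule inj_onI)
    fix x y assume xy: "x \<in> H" "y \<in> H" "C x = C y"
    then have "q (C (x - y)) (x - y) = 0" using sa by (simp add: self_adjoint_linear)
    then show "x = y" using pos[of "x - y"] xy by fastforce
  qed
  ultimately show ?thesis by (auto simp: bij_betw_def)
qed

lemma positive_inv_into:
  assumes bij: "bij_betw C H H" and C: "positive C"
  shows "positive (inv_into H C)"
proof -
  have m: "inv_into H C x \<in> H" "C (inv_into H C x) = x" if "x \<in> H" for x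
    using bij that by (auto simp: bij_betw_def inv_into_into f_inv_into_f)
  have sa: "self_adjoint C" and pos: "\<And>x. x \<in> H \<Longrightarrow> 0 \<le> q (C x) x"
    using C by (auto simp: positive_def)
  have "q (inv_into H C x) y = q x (inv_into H C y)" if "x \<in> H" "y \<in> H" for x y
    using that m self_adjointD(2)[OF sa m(1)[OF that(1)] m(1)[OF that(2)]] by simp
  moreover have "0 \<le> q (inv_into H C x) x" if "x \<in> H" for x
    using pos[OF m(1)[OF that]] m[OF that] that by (simp add: sym)
  ultimately show ?thesis using m by (simp add: positive_def self_adjoint_def)
qed

end

section \<open>Grid functions and the spectral theorem\<close>

text \<open>
  With the pointwise vector space structure on functions, the abstract results apply directly to grid
  functions.
\<close>

instantiation "fun" :: (type, scaleR) scaleR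
begin

definition scaleR_fun_def: "c *\<^sub>R f = (\<lambda>x. c *\<^sub>R f x)"

instance ..

end

instance "fun" :: (type, real_vector) real_vector
  by standard (auto simp: scaleR_fun_def fun_eq_iff algebra_simps)

lemma scaleR_fun_apply [simp]: "(c *\<^sub>R f) x = c *\<^sub>R f x"
  by (simp add: scaleR_fun_def)

lemma finite_interior_nodes: "finite (interior_nodes (N :: 'n::finite \<Rightarrow> nat))"
proof (rule finite_subset)
  show "interior_nodes N \<subseteq> (\<Pi>\<^sub>E k\<in>UNIV. {..<N k})" by (auto simp: interior_nodes_def)
  show "finite (\<Pi>\<^sub>E k\<in>UNIV. {..<N k})" by (intro finite_PiE) auto
qed

locale grid =
  fixes N :: "'n::finite \<Rightarrow> nat" and h :: "'n \<Rightarrow> real"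
  assumes h_pos: "\<And>k. 0 < h k"
begin

abbreviation J where "J \<equiv> interior_nodes N"
abbreviation cell where "cell \<equiv> \<Prod>k\<in>UNIV. h k"

lemma finite_J [simp]: "finite J" by (rule finite_interior_nodes)

lemma cell_pos [simp]: "0 < cell" by (intro prod_pos) (simp add: h_pos)

lemma H_space_iff: "w \<in> H_space N \<longleftrightarrow> (\<forall>i. i \<notin> J \<longrightarrow> w i = 0)"
  by (simp add: H_space_def)

lemma grid_eqI:
  "\<lbrakk>x \<in> H_space N; y \<in> H_space N; \<And>i. i \<in> J \<Longrightarrow> x i = y i\<rbrakk> \<Longrightarrow> x = y"
  by (metis H_space_iff ext)

lemma inner_h_commute: "inner_h N h x y = inner_h N h y x"
  by (simp only: inner_h_def mult.commute)

sublocale inner_on "H_space N" "inner_h N h"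
proof
  show "subspace (H_space N)" by (auto simp: subspace_def H_space_def)
  show "inner_h N h (x + y) z = inner_h N h x z + inner_h N h y z" for x y z
    by (simp add: inner_h_def algebra_simps sum.distrib)
  show "inner_h N h (c *\<^sub>R x) z = c * inner_h N h x z" for c x z
    by (simp add: inner_h_def sum_distrib_left algebra_simps)
  show "inner_h N h x y = inner_h N h y x" for x y
    by (rule inner_h_commute)
  show "0 \<le> inner_h N h x x" for x
    unfolding inner_h_def
    by (rule mult_nonneg_nonneg[OF less_imp_le[OF cell_pos]]) (auto intro: sum_nonneg)
  show "x = 0" if "x \<in> H_space N" "inner_h N h x x = 0" for x
  proof -
    have "cell \<noteq> 0" using cell_pos by linarith
    then have "(\<Sum>i\<in>J. x i * x i) = 0" using that(2) by (simp only: inner_h_def mult_eq_0_iff) simp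
    then have "\<forall>i\<in>J. x i = 0" by (subst (asm) sum_nonneg_eq_0_iff) auto
    then show ?thesis using that(1) by (auto simp: H_space_iff fun_eq_iff)
  qed
qed

text \<open>
  The unit grid functions turn inner products into point values.
\<close>

definition delta :: "('n \<Rightarrow> nat) \<Rightarrow> 'n grid" where "delta i = (\<lambda>j. if j = i then 1 else 0)"

lemma delta_mem: "i \<in> J \<Longrightarrow> delta i \<in> H_space N"
  by (auto simp: delta_def H_space_iff)

lemma inner_delta: "i \<in> J \<Longrightarrow> inner_h N h x (delta i) = cell * x i"
  by (simp add: inner_h_def delta_def if_distrib cong: if_cong)

text \<open>
  The space has finite dimension.  Bessel's inequality for the unit function of a node bounds the sum of
  the squared values at that node; summing over the nodes counts the orthonormal set.
\<close>

lemma card_orthonormal: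
  assumes B: "orthonormal B"
  shows "card B \<le> card J"
proof -
  have "(\<Sum>e\<in>B. (cell * e i)\<^sup>2) \<le> cell" if "i \<in> J" for i
  proof -
    have coeff: "inner_h N h (delta i) e = cell * e i" for e
      by (simp only: inner_h_commute[of "delta i"] inner_delta[OF that])
    have "delta i i = 1" by (simp add: delta_def)
    then show ?thesis using bessel[OF B delta_mem[OF that]] by (simp only: coeff)
  qed
  then have "(\<Sum>i\<in>J. \<Sum>e\<in>B. (cell * e i)\<^sup>2) \<le> (\<Sum>i\<in>J. cell)" by (rule sum_mono)
  also have "(\<Sum>i\<in>J. \<Sum>e\<in>B. (cell * e i)\<^sup>2) = (\<Sum>e\<in>B. \<Sum>i\<in>J. (cell * e i)\<^sup>2)"
    by (rule sum.swap)
  also have "\<dots> = (\<Sum>e\<in>B. cell * inner_h N h e e)"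
    by (simp only: inner_h_def power2_eq_square sum_distrib_left ac_simps)
  also have "\<dots> = card B * cell" using B by (simp add: orthonormal_def)
  finally show ?thesis using cell_pos by simp
qed

lemma continuous_inner: "continuous_on UNIV (\<lambda>x. inner_h N h x y)"
  unfolding inner_h_def by (intro continuous_intros continuous_on_product_coordinates)

lemma continuous_inner_self: "continuous_on UNIV (\<lambda>x. inner_h N h x x)"
  unfolding inner_h_def by (intro continuous_intros continuous_on_product_coordinates)

lemma continuous_quadratic_form:
  assumes C: "self_adjoint C"
  shows "continuous_on (H_space N) (\<lambda>x. inner_h N h (C x) x)"
proof -
  have eq: "inner_h N h (C x) x = (\<Sum>i\<in>J. inner_h N h x (C (delta i)) * x i)" if "x \<in> H_space N" for x
  proof -
    have "cell * C x i = inner_h N h x (C (delta i))" if "i \<in> J" for i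
      using inner_delta[OF that, of "C x"] C \<open>x \<in> H_space N\<close> delta_mem[OF that]
      by (simp add: self_adjointD)
    then show ?thesis by (simp add: inner_h_def[of N h "C x"] sum_distrib_left mult.assoc[symmetric])
  qed
  have "continuous_on (H_space N) (\<lambda>x. \<Sum>i\<in>J. inner_h N h x (C (delta i)) * x i)"
    unfolding inner_h_def by (intro continuous_intros continuous_on_subset[OF continuous_on_product_coordinates]) auto
  then show ?thesis using eq by (simp cong: continuous_on_cong)
qed

text \<open>
  Functions carry the product topology, and the unit sphere is a closed part of a product of compact
  intervals.
\<close>

lemma compact_unit_sphere:
  assumes V: "closed V"
  shows "compact {x \<in> V \<inter> H_space N. inner_h N h x x = 1}"
proof -
  \<comment> \<open>values of a unit grid function are at most \<open>r\<close> in absolute value\<close>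
  define r where "r = 1 / sqrt cell"
  have r: "r\<^sup>2 = 1 / cell" using less_imp_le[OF cell_pos] by (simp add: r_def power_divide)
  let ?K = "\<Pi>\<^sub>E i\<in>UNIV. if i \<in> J then {-r..r} else {0::real}"
  have "compactin (product_topology (\<lambda>i::'n \<Rightarrow> nat. euclidean) UNIV) ?K"
    by (subst compactin_PiE) auto
  then have K: "compact ?K" by (simp add: euclidean_product_topology)
  have "closed (V \<inter> {x. inner_h N h x x = 1})"
    using closed_Collect_eq[OF continuous_inner_self continuous_on_const] V by (rule closed_Int[rotated])
  moreover have "{x \<in> V \<inter> H_space N. inner_h N h x x = 1} = ?K \<inter> (V \<inter> {x. inner_h N h x x = 1})"
  proof -
    have "\<bar>x i\<bar> \<le> r" if "inner_h N h x x = 1" "i \<in> J" for x i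
    proof -
      have "x i * x i \<le> (\<Sum>i\<in>J. x i * x i)" using that by (intro member_le_sum) auto
      also have "\<dots> = r\<^sup>2"
        using that(1) cell_pos unfolding r inner_h_def
        by (metis less_irrefl nonzero_mult_div_cancel_left)
      finally have "(x i)\<^sup>2 \<le> r\<^sup>2" by (simp add: power2_eq_square)
      moreover have "0 \<le> r" unfolding r_def using less_imp_le[OF cell_pos] by simp
      ultimately show ?thesis by (simp add: power2_le_iff_abs_le)
    qed
    then have "x \<in> ?K" if "x \<in> H_space N" "inner_h N h x x = 1" for x
      using that by (auto simp: H_space_iff PiE_iff abs_le_iff minus_le_iff)
    moreover have "x \<in> H_space N" if "x \<in> ?K" for x
      using that by (auto simp: H_space_iff PiE_iff split: if_splits)
    ultimately show ?thesis by blast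
  qed
  ultimately show ?thesis using compact_Int_closed[OF K] by simp
qed

text \<open>
  A largest orthonormal set \<open>B\<close> of eigenvectors exists since cardinalities are bounded.  Its orthogonal
  complement \<open>V\<close> is invariant.  If \<open>V\<close> were nontrivial, a maximizer of the quadratic form on its unit sphere
  would be a further eigenvector.
\<close>

theorem eigenbasis_exists:
  assumes C: "self_adjoint C"
  shows "\<exists>B. eigenbasis C B"
proof -
  let ?P = "\<lambda>B. orthonormal B \<and> (\<forall>e\<in>B. C e = inner_h N h (C e) e *\<^sub>R e)"
  have "?P {}" by (simp add: orthonormal_def)
  then obtain B where B: "?P B" and max: "\<And>B'. ?P B' \<Longrightarrow> card B' \<le> card B"
    using ex_has_greatest_nat[of ?P "{}" card "Suc (card J)"] card_orthonormal
    by (auto simp: less_Suc_eq_le)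
  have BH: "e \<in> H_space N" if "e \<in> B" for e using that B unfolding orthonormal_def by blast
  have "x = 0" if x: "x \<in> H_space N" "\<And>e. e \<in> B \<Longrightarrow> inner_h N h x e = 0" for x
  proof (rule ccontr)
    assume "x \<noteq> 0"
    define V where "V = {x. \<forall>e\<in>B. inner_h N h x e = 0} \<inter> H_space N"
    let ?S = "{x \<in> {x. \<forall>e\<in>B. inner_h N h x e = 0} \<inter> H_space N. inner_h N h x x = 1}"
    have normalize: "(1 / sqrt (inner_h N h y y)) *\<^sub>R y \<in> ?S" if "y \<in> V" "y \<noteq> 0" for y
    proof -
      have "inner_h N h y y \<noteq> 0" using that definite by (auto simp: V_def)
      then have "0 < inner_h N h y y" using nonneg[of y] that by (simp add: V_def)
      then show ?thesis using that by (auto simp: V_def bilinear BH)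
    qed
    have "closed (\<Inter>e\<in>B. {x. inner_h N h x e = 0})"
      by (intro closed_INT ballI closed_Collect_eq continuous_inner continuous_on_const)
    then have "closed {x. \<forall>e\<in>B. inner_h N h x e = 0}" by (simp add: INTER_eq)
    then have "compact ?S" by (rule compact_unit_sphere)
    moreover have "x \<in> V" using x by (simp add: V_def)
    then have "?S \<noteq> {}" using normalize[of x] \<open>x \<noteq> 0\<close> by blast
    moreover have "continuous_on ?S (\<lambda>x. inner_h N h (C x) x)"
      by (rule continuous_on_subset[OF continuous_quadratic_form[OF C]]) auto
    ultimately obtain e where e: "e \<in> ?S"
      and emax: "\<And>y. y \<in> ?S \<Longrightarrow> inner_h N h (C y) y \<le> inner_h N h (C e) e"
      using continuous_attains_sup[of ?S "\<lambda>x. inner_h N h (C x) x"] by auto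
    let ?\<mu> = "inner_h N h (C e) e"
    have "C e = ?\<mu> *\<^sub>R e"
    proof (rule maximizer_is_eigenvector[OF C, of V])
      show "subspace V" by (auto simp: subspace_def V_def bilinear BH)
      show "V \<subseteq> H_space N" by (simp add: V_def)
      have "inner_h N h (C y) d = 0" if "y \<in> V" "d \<in> B" for y d
      proof -
        have Cd: "C d = inner_h N h (C d) d *\<^sub>R d" using that B by blast
        have "inner_h N h (C y) d = inner_h N h y (C d)"
          using that C BH by (simp add: self_adjointD(2) V_def)
        also have "\<dots> = inner_h N h y (inner_h N h (C d) d *\<^sub>R d)" by (rule arg_cong[OF Cd])
        also have "\<dots> = 0" using that by (simp add: scale_right V_def BH)
        finally show ?thesis .
      qed
      then show "C ` V \<subseteq> V" using C by (auto simp: V_def self_adjointD)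
      show "e \<in> V" "?\<mu> = ?\<mu> * inner_h N h e e" using e by (auto simp: V_def)
      show "inner_h N h (C y) y \<le> ?\<mu> * inner_h N h y y" if "y \<in> V" for y
      proof (cases "y = 0")
        case True
        then show ?thesis using C by (simp add: self_adjointD)
      next
        case False
        have y: "y \<in> H_space N" "C y \<in> H_space N" using that C by (auto simp: V_def self_adjointD)
        have "inner_h N h y y \<noteq> 0" using False y definite by auto
        then have pos: "0 < inner_h N h y y" using nonneg[OF y(1)] by simp
        have "inner_h N h (C y) y / inner_h N h y y \<le> ?\<mu>"
        proof -
          let ?c = "1 / sqrt (inner_h N h y y)"
          have "inner_h N h (C (?c *\<^sub>R y)) (?c *\<^sub>R y) = ?c * (?c * inner_h N h (C y) y)"
            using y by (simp only: self_adjoint_linear(3)[OF C y(1)] scale_left scale_right mem)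
          also have "\<dots> = inner_h N h (C y) y / inner_h N h y y" using pos by simp
          finally show ?thesis using emax[OF normalize[OF that False]] by simp
        qed
        then show ?thesis using pos by (simp add: divide_le_eq)
      qed
    qed
    moreover have "e \<notin> B" using e by auto
    moreover have "orthonormal (insert e B)"
      using conjunct1[OF B] e BH \<open>e \<notin> B\<close> sym[of e] by (auto simp: orthonormal_def)
    ultimately have "?P (insert e B)" using B by blast
    moreover have "card (insert e B) = Suc (card B)"
      using B \<open>e \<notin> B\<close> by (simp add: orthonormal_def)
    ultimately show False using max by (metis Suc_n_not_le_n)
  qed
  then show ?thesis using B unfolding eigenbasis_def by blast
qed

lemma op_inv_positive_definite:
  assumes "positive_definite C"
  shows "bij_betw C (H_space N) (H_space N)" "positive (op_inv N C)"
    "x \<in> H_space N \<Longrightarrow> op_inv N C x \<in> H_space N"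
    "x \<in> H_space N \<Longrightarrow> C (op_inv N C x) = x"
    "x \<in> H_space N \<Longrightarrow> op_inv N C (C x) = x"
proof -
  show bij: "bij_betw C (H_space N) (H_space N)"
    using assms eigenbasis_exists[of C] positive_definite_bij by (auto simp: positive_definite_def)
  then show "positive (op_inv N C)"
    using assms positive_definite_positive positive_inv_into by (simp add: op_inv_def)
  show "x \<in> H_space N \<Longrightarrow> op_inv N C x \<in> H_space N" "x \<in> H_space N \<Longrightarrow> C (op_inv N C x) = x"
    "x \<in> H_space N \<Longrightarrow> op_inv N C (C x) = x"
    using bij by (auto simp: op_inv_def bij_betw_def inv_into_into f_inv_into_f)
qed

text \<open>
  Whichever square root \<open>S\<close> is chosen, \<open>(S x, S x) = (S (S x), x) = (C x, x)\<close>.  The functional calculus shows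
  that there is one to choose.
\<close>

lemma norm_op_sqrt:
  assumes C: "positive C" and x: "x \<in> H_space N"
  shows "norm_h N h (op_sqrt N h C x) = sqrt (inner_h N h (C x) x)"
proof -
  have sa: "self_adjoint C" and pos: "\<And>x. x \<in> H_space N \<Longrightarrow> 0 \<le> inner_h N h (C x) x"
    using C by (auto simp: positive_def)
  obtain B where B: "eigenbasis C B" using eigenbasis_exists[OF sa] by blast
  let ?S = "func_calc C B sqrt"
  have nn: "0 \<le> inner_h N h (C e) e" if "e \<in> B" for e
    using pos B that by (simp add: eigenbasisD)
  have S: "positive ?S" using B nn by (intro func_calc_positive) auto
  have "?S (?S y) = C y" if "y \<in> H_space N" for y
  proof -
    have "?S (?S y) = func_calc C B (\<lambda>t. t) y"
      using B nn by (subst func_calc_comp) (auto simp: func_calc_def intro!: sum.cong)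
    then show ?thesis using func_calc_id[OF B sa that] by simp
  qed
  then have "is_op_sqrt N h C ?S"
    using S by (auto simp: is_op_sqrt_def positive_def self_adjoint_def)
  then have "is_op_sqrt N h C (op_sqrt N h C)"
    unfolding op_sqrt_def by (rule someI[where P = "is_op_sqrt N h C"])
  then have "inner_h N h (op_sqrt N h C x) (op_sqrt N h C x) = inner_h N h (C x) x"
    using x unfolding is_op_sqrt_def by metis
  then show ?thesis by (simp add: norm_h_def)
qed

end

section \<open>Weighted sums of self-adjoint operators\<close>

context inner_on
begin

lemma self_adjoint_id: "self_adjoint (\<lambda>x. x)"
  by (simp add: self_adjoint_def)

lemma self_adjoint_add:
  assumes "self_adjoint C" "self_adjoint D"
  shows "self_adjoint (\<lambda>x. C x + D x)"
  using assms by (auto simp: self_adjoint_def bilinear)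

lemma self_adjoint_scale: "self_adjoint C \<Longrightarrow> self_adjoint (\<lambda>x. c *\<^sub>R C x)"
  by (auto simp: self_adjoint_def bilinear)

lemma inner_weighted_sum:
  assumes "\<And>k. k \<in> K \<Longrightarrow> self_adjoint (C k)" "x \<in> H" "y \<in> H"
  shows "q (\<Sum>k\<in>K. c k *\<^sub>R C k x) y = (\<Sum>k\<in>K. c k * q (C k x) y)"
proof -
  have "q (\<Sum>k\<in>K. c k *\<^sub>R C k x) y = (\<Sum>k\<in>K. q (c k *\<^sub>R C k x) y)"
    using assms by (intro sum_left) (auto simp: self_adjointD(1))
  also have "\<dots> = (\<Sum>k\<in>K. c k * q (C k x) y)"
    using assms by (intro sum.cong refl) (simp add: self_adjointD(1) scale_left)
  finally show ?thesis .
qed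

lemma self_adjoint_weighted_sum:
  assumes C: "\<And>k. k \<in> K \<Longrightarrow> self_adjoint (C k)"
  shows "self_adjoint (\<lambda>x. \<Sum>k\<in>K. c k *\<^sub>R C k x)"
  unfolding self_adjoint_def
proof (intro conjI ballI)
  show mem: "(\<Sum>k\<in>K. c k *\<^sub>R C k x) \<in> H" if "x \<in> H" for x
    using that C by (intro sum_mem) (simp add: self_adjointD(1))
  show "q (\<Sum>k\<in>K. c k *\<^sub>R C k x) y = q x (\<Sum>k\<in>K. c k *\<^sub>R C k y)" if xy: "x \<in> H" "y \<in> H" for x y
  proof -
    have "q (C k x) y = q (C k y) x" if "k \<in> K" for k
      using C[OF that] xy by (simp add: self_adjointD sym[of x])
    then have "q (\<Sum>k\<in>K. c k *\<^sub>R C k x) y = q (\<Sum>k\<in>K. c k *\<^sub>R C k y) x"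
      using C xy by (simp add: inner_weighted_sum)
    then show ?thesis using mem[OF xy(2)] xy by (simp add: sym[of x])
  qed
qed

end

lemma sum_fun_apply: "(\<Sum>k\<in>K. f k) i = (\<Sum>k\<in>K. f k i)" for f :: "'a \<Rightarrow> 'b \<Rightarrow> real"
  by (induction K rule: infinite_finite_induct) auto

section \<open>The difference operators\<close>

context grid
begin

definition up :: "'n \<Rightarrow> ('n \<Rightarrow> nat) \<Rightarrow> 'n \<Rightarrow> nat" where "up k i = i(k := i k + 1)"
definition down :: "'n \<Rightarrow> ('n \<Rightarrow> nat) \<Rightarrow> 'n \<Rightarrow> nat" where "down k i = i(k := i k - 1)"

lemma down_up [simp]: "down k (up k i) = i"
  by (simp add: up_def down_def)

lemma up_down: "i \<in> J \<Longrightarrow> up k (down k i) = i"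
  by (auto simp: up_def down_def interior_nodes_def fun_eq_iff)
    (metis Suc_pred less_eq_Suc_le)

text \<open>
  Summation by parts.  The shifts pair the nodes with an interior lower neighbour with those with an interior
  upper neighbour, and all other terms vanish by the boundary values.
\<close>

lemma sum_down_up:
  assumes w: "w \<in> H_space N" and v: "v \<in> H_space N"
  shows "(\<Sum>i\<in>J. w (down k i) * v i) = (\<Sum>i\<in>J. v (up k i) * w i)"
proof -
  have "(\<Sum>i\<in>J. w (down k i) * v i) = (\<Sum>i\<in>{i\<in>J. down k i \<in> J}. w (down k i) * v i)"
    using w by (intro sum.mono_neutral_right) (auto simp: H_space_iff)
  also have "\<dots> = (\<Sum>i\<in>{i\<in>J. up k i \<in> J}. v (up k i) * w i)"
    by (rule sum.reindex_bij_witness[of _ "up k" "down k"]) (auto simp: up_down mult.commute)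
  also have "\<dots> = (\<Sum>i\<in>J. v (up k i) * w i)"
    using v by (intro sum.mono_neutral_left) (auto simp: H_space_iff)
  finally show ?thesis .
qed

lemma sum_up_sq_le:
  assumes w: "w \<in> H_space N"
  shows "(\<Sum>i\<in>J. (w (up k i))\<^sup>2) \<le> (\<Sum>i\<in>J. (w i)\<^sup>2)"
proof -
  have "(\<Sum>i\<in>J. (w (up k i))\<^sup>2) = (\<Sum>i\<in>{i\<in>J. up k i \<in> J}. (w (up k i))\<^sup>2)"
    using w by (intro sum.mono_neutral_right) (auto simp: H_space_iff)
  also have "\<dots> = (\<Sum>i\<in>{i\<in>J. down k i \<in> J}. (w i)\<^sup>2)"
    by (rule sum.reindex_bij_witness[of _ "down k" "up k"]) (auto simp: up_down)
  also have "\<dots> \<le> (\<Sum>i\<in>J. (w i)\<^sup>2)" by (intro sum_mono2) auto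
  finally show ?thesis .
qed

text \<open>
  Both bounds come from \<open>(w (up k i) \<plusminus> w i)\<^sup>2 \<ge> 0\<close>.  Equality in the second would make \<open>w\<close> alternate in sign
  along the direction \<open>k\<close>, which the zero value on the far boundary excludes unless \<open>w = 0\<close>.  This strictness
  is what makes \<open>I_rho\<close> positive definite in the limiting case of the stability condition.
\<close>

lemma shift_product_bounds:
  assumes w: "w \<in> H_space N"
  shows "(\<Sum>i\<in>J. w (up k i) * w i) \<le> (\<Sum>i\<in>J. (w i)\<^sup>2)"
    and "w \<noteq> 0 \<Longrightarrow> - (\<Sum>i\<in>J. (w i)\<^sup>2) < (\<Sum>i\<in>J. w (up k i) * w i)"
proof -
  have "0 \<le> (\<Sum>i\<in>J. (w (up k i) - w i)\<^sup>2)" by (intro sum_nonneg) simp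
  also have "\<dots> = (\<Sum>i\<in>J. (w (up k i))\<^sup>2) + (\<Sum>i\<in>J. (w i)\<^sup>2) - 2 * (\<Sum>i\<in>J. w (up k i) * w i)"
    by (simp add: power2_diff sum.distrib sum_subtractf sum_distrib_left mult.assoc)
  finally show "(\<Sum>i\<in>J. w (up k i) * w i) \<le> (\<Sum>i\<in>J. (w i)\<^sup>2)"
    using sum_up_sq_le[OF w, of k] by linarith
  assume "w \<noteq> 0"
  have "\<exists>i\<in>J. w (up k i) + w i \<noteq> 0"
  proof (rule ccontr)
    assume "\<not> (\<exists>i\<in>J. w (up k i) + w i \<noteq> 0)"
    then have alt: "w i = - w (up k i)" if "i \<in> J" for i using that by (simp add: eq_neg_iff_add_eq_0 add.commute)
    have "w i = 0" for i
    \<comment> \<open>downward from the boundary where the \<open>k\<close>-th index is \<open>N k\<close>\<close>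
    proof (induction "N k - i k" arbitrary: i)
      case 0
      then have "\<not> i k < N k" by simp
      then have "i \<notin> J" by (auto simp: interior_nodes_def)
      then show ?case using w by (simp add: H_space_iff)
    next
      case (Suc d)
      then have "w (up k i) = 0" by (intro Suc.hyps(1)) (simp add: up_def)
      then show ?case using alt[of i] w by (cases "i \<in> J") (auto simp: H_space_iff)
    qed
    then show False using \<open>w \<noteq> 0\<close> by (simp add: fun_eq_iff)
  qed
  then obtain j where "j \<in> J" "w (up k j) + w j \<noteq> 0" by blast
  then have "0 < (\<Sum>i\<in>J. (w (up k i) + w i)\<^sup>2)" by (intro sum_pos2[of J j]) auto
  also have "\<dots> = (\<Sum>i\<in>J. (w (up k i))\<^sup>2) + (\<Sum>i\<in>J. (w i)\<^sup>2) + 2 * (\<Sum>i\<in>J. w (up k i) * w i)"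
    by (simp add: power2_sum sum.distrib sum_distrib_left mult.assoc)
  finally show "- (\<Sum>i\<in>J. (w i)\<^sup>2) < (\<Sum>i\<in>J. w (up k i) * w i)"
    using sum_up_sq_le[OF w, of k] by linarith
qed

lemma inner_Lambda:
  assumes w: "w \<in> H_space N" and v: "v \<in> H_space N"
  shows "inner_h N h (Lambda_k N h k w) v = cell / (h k)\<^sup>2 *
    ((\<Sum>i\<in>J. w (up k i) * v i) + (\<Sum>i\<in>J. v (up k i) * w i) - 2 * (\<Sum>i\<in>J. w i * v i))"
proof -
  have "(\<Sum>i\<in>J. Lambda_k N h k w i * v i) = (\<Sum>i\<in>J. (w (up k i) * v i + w (down k i) * v i - 2 * (w i * v i)) / (h k)\<^sup>2)"
    by (intro sum.cong refl) (simp add: Lambda_k_def up_def down_def field_simps)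
  also have "\<dots> = ((\<Sum>i\<in>J. w (up k i) * v i) + (\<Sum>i\<in>J. w (down k i) * v i) - 2 * (\<Sum>i\<in>J. w i * v i)) / (h k)\<^sup>2"
    by (simp only: sum_divide_distrib[symmetric] sum.distrib sum_subtractf sum_distrib_left[symmetric])
  finally show ?thesis
    unfolding inner_h_def sum_down_up[OF w v] by simp
qed

lemma self_adjoint_Lambda: "self_adjoint (Lambda_k N h k)"
proof -
  have "Lambda_k N h k w \<in> H_space N" for w by (simp add: H_space_iff Lambda_k_def)
  moreover have "inner_h N h (Lambda_k N h k w) v = inner_h N h w (Lambda_k N h k v)"
    if "w \<in> H_space N" "v \<in> H_space N" for w v
    unfolding inner_h_commute[of w] inner_Lambda[OF that] inner_Lambda[OF that(2,1)]
    by (simp add: mult.commute add.commute)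
  ultimately show ?thesis by (simp add: self_adjoint_def)
qed

lemma Lambda_mem: "Lambda_k N h k w \<in> H_space N"
  by (simp add: H_space_iff Lambda_k_def)

lemma Lambda_bounds:
  assumes w: "w \<in> H_space N"
  shows "inner_h N h (Lambda_k N h k w) w \<le> 0"
    and "w \<noteq> 0 \<Longrightarrow> - (4 / (h k)\<^sup>2 * inner_h N h w w) < inner_h N h (Lambda_k N h k w) w"
proof -
  define s t where "s = (\<Sum>i\<in>J. (w i)\<^sup>2)" and "t = (\<Sum>i\<in>J. w (up k i) * w i)"
  have L: "inner_h N h (Lambda_k N h k w) w = cell / (h k)\<^sup>2 * (2 * t - 2 * s)"
    unfolding inner_Lambda[OF w w] by (simp only: s_def t_def power2_eq_square) simp
  have c: "0 < cell / (h k)\<^sup>2" using h_pos[of k] cell_pos by (intro divide_pos_pos) (simp_all del: cell_pos)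
  have "cell / (h k)\<^sup>2 * (2 * t - 2 * s) \<le> cell / (h k)\<^sup>2 * 0"
    using shift_product_bounds(1)[OF w, of k] c by (intro mult_left_mono) (auto simp: s_def t_def)
  then show "inner_h N h (Lambda_k N h k w) w \<le> 0" by (simp add: L)
  assume "w \<noteq> 0"
  then have "cell / (h k)\<^sup>2 * (- 4 * s) < cell / (h k)\<^sup>2 * (2 * t - 2 * s)"
    using shift_product_bounds(2)[OF w, of k] c by (intro mult_strict_left_mono) (auto simp: s_def t_def)
  moreover have "inner_h N h w w = cell * s" by (simp add: inner_h_def s_def power2_eq_square)
  ultimately show "- (4 / (h k)\<^sup>2 * inner_h N h w w) < inner_h N h (Lambda_k N h k w) w"
    by (simp add: L algebra_simps)
qed

lemma s_k_eq: "w \<in> H_space N \<Longrightarrow> s_k N k w = w + ((h k)\<^sup>2 / 12) *\<^sub>R Lambda_k N h k w"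
  using h_pos[of k] by (auto simp: fun_eq_iff s_k_def Lambda_k_def H_space_iff field_simps)

lemma self_adjoint_s: "self_adjoint (s_k N k)"
proof -
  have "self_adjoint (\<lambda>w. w + ((h k)\<^sup>2 / 12) *\<^sub>R Lambda_k N h k w)"
    by (intro self_adjoint_add self_adjoint_id self_adjoint_scale self_adjoint_Lambda)
  then show ?thesis by (simp add: self_adjoint_def s_k_eq)
qed

lemma s_le: "w \<in> H_space N \<Longrightarrow> inner_h N h (s_k N k w) w \<le> 1 * inner_h N h w w"
  using Lambda_bounds(1)[of w k] by (simp add: s_k_eq bilinear Lambda_mem mult_nonneg_nonpos)

lemma positive_definite_s: "positive_definite (s_k N k)"
  unfolding positive_definite_def
proof (intro conjI ballI impI self_adjoint_s)
  fix w assume w: "w \<in> H_space N" "w \<noteq> 0"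
  have "(h k)\<^sup>2 / 12 * (- (4 / (h k)\<^sup>2 * inner_h N h w w)) < (h k)\<^sup>2 / 12 * inner_h N h (Lambda_k N h k w) w"
    using Lambda_bounds(2)[OF w, of k] h_pos[of k] by (intro mult_strict_left_mono) auto
  then have "- (1 / 3 * inner_h N h w w) < (h k)\<^sup>2 / 12 * inner_h N h (Lambda_k N h k w) w"
    using h_pos[of k] by simp
  then show "0 < inner_h N h (s_k N k w) w"
    using nonneg[OF w(1)] w by (simp add: s_k_eq bilinear Lambda_mem)
qed

lemmas inv_s = op_inv_positive_definite[OF positive_definite_s]

abbreviation sLambda where "sLambda k w \<equiv> op_inv N (s_k N k) (Lambda_k N h k w)"

lemma Lambda_s_commute:
  assumes "w \<in> H_space N"
  shows "Lambda_k N h k (s_k N k w) = s_k N k (Lambda_k N h k w)"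
  using assms by (simp add: s_k_eq self_adjoint_linear[OF self_adjoint_Lambda] Lambda_mem)

lemma sLambda_s: "w \<in> H_space N \<Longrightarrow> sLambda k (s_k N k w) = Lambda_k N h k w"
  by (simp add: Lambda_s_commute inv_s Lambda_mem)

text \<open>
  The inverse of \<open>s_k\<close> commutes with the second difference, because \<open>s_k\<close> is a polynomial in it.
\<close>

lemma self_adjoint_sLambda: "self_adjoint (sLambda k)"
  unfolding self_adjoint_def
proof (intro conjI ballI)
  show "sLambda k w \<in> H_space N" for w by (simp add: inv_s Lambda_mem)
  fix v w assume "v \<in> H_space N" "w \<in> H_space N"
  then obtain y z where yz: "v = s_k N k y" "w = s_k N k z" "y \<in> H_space N" "z \<in> H_space N"
    using inv_s(3,4) by metis
  have "inner_h N h (Lambda_k N h k y) (s_k N k z) = inner_h N h y (Lambda_k N h k (s_k N k z))"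
    using yz by (intro self_adjointD(2)[OF self_adjoint_Lambda]) (simp_all add: self_adjointD(1)[OF self_adjoint_s])
  also have "\<dots> = inner_h N h (s_k N k y) (Lambda_k N h k z)"
    using yz by (simp add: Lambda_s_commute Lambda_mem self_adjointD(2)[OF self_adjoint_s])
  finally show "inner_h N h (sLambda k v) w = inner_h N h v (sLambda k w)"
    using yz by (simp add: sLambda_s)
qed

text \<open>
  For \<open>w = s y\<close> the inner product is \<open>(\<Lambda> y, s y)\<close>, and \<open>(h\<^sup>2 / 12) \<Lambda> = s - I\<close> turns it into a positive multiple of
  \<open>(s y, s y) - (y, s y)\<close>, which is nonpositive since \<open>0 < s \<le> I\<close>.
\<close>

lemma sLambda_nonpos:
  assumes "w \<in> H_space N"
  shows "inner_h N h (sLambda k w) w \<le> 0"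
proof -
  obtain y where y: "w = s_k N k y" "y \<in> H_space N" using assms inv_s(3,4) by metis
  have "inner_h N h (s_k N k y) (s_k N k y) \<le> 1 * inner_h N h (s_k N k y) y"
    using positive_definite_positive[OF positive_definite_s] s_le y(2) by (rule positive_bounded_sq)
  moreover have "inner_h N h (s_k N k y) z
      = inner_h N h y z + (h k)\<^sup>2 / 12 * inner_h N h (Lambda_k N h k y) z" if "z \<in> H_space N" for z
    using that y(2) Lambda_mem by (simp add: s_k_eq add_left scale_left)
  from this[OF assms] have "inner_h N h (s_k N k y) w
      = inner_h N h y w + (h k)\<^sup>2 / 12 * inner_h N h (Lambda_k N h k y) w" .
  ultimately have "(h k)\<^sup>2 / 12 * inner_h N h (Lambda_k N h k y) w \<le> 0"
    using y by (simp add: inner_h_commute[of y])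
  then show ?thesis using y h_pos[of k] by (simp add: sLambda_s mult_le_0_iff)
qed

lemma E_h_eq: "E_h N h a = (\<lambda>w. (- 1) *\<^sub>R (\<Sum>k\<in>UNIV. (a k)\<^sup>2 *\<^sub>R sLambda k w))"
  by (simp add: fun_eq_iff E_h_def sum_fun_apply)

lemma positive_E: "positive (E_h N h a)"
  unfolding positive_def
proof (intro conjI ballI)
  show sa: "self_adjoint (E_h N h a)"
    unfolding E_h_eq by (intro self_adjoint_scale self_adjoint_weighted_sum self_adjoint_sLambda)
  fix w assume w: "w \<in> H_space N"
  have mem: "(\<Sum>k\<in>UNIV. (a k)\<^sup>2 *\<^sub>R sLambda k w) \<in> H_space N"
    by (intro sum_mem mem(4) inv_s(3) Lambda_mem)
  have "inner_h N h (E_h N h a w) w = - (\<Sum>k\<in>UNIV. (a k)\<^sup>2 * inner_h N h (sLambda k w) w)"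
    unfolding E_h_eq scale_left[OF mem w] inner_weighted_sum[OF self_adjoint_sLambda w w] by simp
  also have "0 \<le> \<dots>" using sLambda_nonpos[OF w] by (auto intro!: sum_nonpos mult_nonneg_nonpos)
  finally show "0 \<le> inner_h N h (E_h N h a w) w" .
qed

lemma L_h_eq: "L_h N h a = (\<lambda>w. \<Sum>k\<in>UNIV. (a k)\<^sup>2 *\<^sub>R Lambda_k N h k w)"
  by (simp add: fun_eq_iff L_h_def sum_fun_apply)

lemma self_adjoint_L: "self_adjoint (L_h N h a)"
  unfolding L_h_eq by (intro self_adjoint_weighted_sum self_adjoint_Lambda)

lemma inner_L:
  assumes "w \<in> H_space N"
  shows "inner_h N h (L_h N h a w) w = (\<Sum>k\<in>UNIV. (a k)\<^sup>2 * inner_h N h (Lambda_k N h k w) w)"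
  unfolding L_h_eq using assms by (intro inner_weighted_sum self_adjoint_Lambda)

lemma L_nonpos:
  assumes "w \<in> H_space N"
  shows "inner_h N h (L_h N h a w) w \<le> 0"
  unfolding inner_L[OF assms] using Lambda_bounds(1)[OF assms] by (intro sum_nonpos mult_nonneg_nonpos) simp_all

text \<open>
  With the constant \<open>4\<close> for each direction, \<open>ht\<^sup>2 / 12\<close> times this bound is, up to the sign and the factor
  \<open>(w, w)\<close>, the left-hand side of the first stability condition.
\<close>

lemma L_lower:
  assumes w: "w \<in> H_space N" "w \<noteq> 0" and a: "\<And>k. 0 < a k"
  shows "- (4 * (\<Sum>k\<in>UNIV. (a k)\<^sup>2 / (h k)\<^sup>2) * inner_h N h w w) < inner_h N h (L_h N h a w) w"
proof -
  have "- (4 * (\<Sum>k\<in>UNIV. (a k)\<^sup>2 / (h k)\<^sup>2) * inner_h N h w w)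
      = (\<Sum>k\<in>UNIV. (a k)\<^sup>2 * (- (4 / (h k)\<^sup>2 * inner_h N h w w)))"
    by (simp add: sum_distrib_left sum_distrib_right sum_negf[symmetric] algebra_simps)
  also have "\<dots> < (\<Sum>k\<in>UNIV. (a k)\<^sup>2 * inner_h N h (Lambda_k N h k w) w)"
    using Lambda_bounds(2)[OF w] by (intro sum_strict_mono mult_strict_left_mono zero_less_power a) auto
  finally show ?thesis by (simp add: inner_L w)
qed

end

section \<open>The weighted operator of the scheme\<close>

locale wave_grid = grid N h for N :: "'n::finite \<Rightarrow> nat" and h +
  fixes a :: "'n \<Rightarrow> real" and r :: "'n grid" and ht rho_lo :: real
  assumes a_pos: "\<And>k. 0 < a k" and rho_lo_pos: "0 < rho_lo" and ht_pos: "0 < ht"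
    and r_ge: "\<And>i. i \<in> interior_nodes N \<Longrightarrow> rho_lo \<le> r i"
    and stable: "ht\<^sup>2 / 3 * (\<Sum>k\<in>UNIV. (a k)\<^sup>2 / (h k)\<^sup>2) \<le> rho_lo"
begin

abbreviation G where "G \<equiv> I_rho N h ht a r"

lemma r_pos: "i \<in> J \<Longrightarrow> 0 < r i"
  using r_ge rho_lo_pos by (meson less_le_trans)

lemma over_mem: "w \<in> H_space N \<Longrightarrow> over r w \<in> H_space N"
  by (simp add: over_def H_space_iff)

lemma inner_over: "inner_h N h (over r w) v = inner_h N h w (over r v)"
  by (simp add: inner_h_def over_def)

lemma I_rho_eq: "G w = over r w + (ht\<^sup>2 / 12) *\<^sub>R over r (L_h N h a (over r w))"
  by (simp add: I_rho_def fun_eq_iff)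

lemma I_rho_rhoL: "G w = over r (rhoL N h ht a r w)"
  by (simp add: I_rho_def rhoL_def over_def fun_eq_iff add_divide_distrib)

lemma self_adjoint_I_rho: "self_adjoint G"
proof -
  have "self_adjoint (over r)" by (simp add: self_adjoint_def over_mem inner_over)
  moreover have "self_adjoint (\<lambda>w. over r (L_h N h a (over r w)))"
    using self_adjoint_L by (simp add: self_adjoint_def over_mem inner_over)
  ultimately show ?thesis
    unfolding I_rho_eq[abs_def] by (intro self_adjoint_add self_adjoint_scale)
qed

lemma inner_I_rho:
  assumes w: "w \<in> H_space N"
  shows "inner_h N h (G w) w = inner_h N h (over r w) w
    + ht\<^sup>2 / 12 * inner_h N h (L_h N h a (over r w)) (over r w)"
  using w self_adjointD(1)[OF self_adjoint_L, of "over r w"]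
  by (simp add: I_rho_eq bilinear over_mem inner_over[of "L_h N h a (over r w)"])

text \<open>
  The correction by the discrete Laplacian is nonpositive, so only the multiplication by \<open>1 / r\<close> counts.
\<close>

lemma I_rho_le:
  assumes w: "w \<in> H_space N"
  shows "inner_h N h (G w) w \<le> 1 / rho_lo * inner_h N h w w"
proof -
  have "inner_h N h (G w) w \<le> inner_h N h (over r w) w"
    using L_nonpos[OF over_mem[OF w], of a] by (simp add: inner_I_rho w mult_nonneg_nonpos)
  also have "\<dots> \<le> 1 / rho_lo * inner_h N h w w"
  proof -
    have "(\<Sum>i\<in>J. over r w i * w i) \<le> (\<Sum>i\<in>J. 1 / rho_lo * (w i * w i))"
    proof (rule sum_mono)
      fix i assume i: "i \<in> J"
      have "1 / r i * (w i * w i) \<le> 1 / rho_lo * (w i * w i)"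
        using r_ge[OF i] rho_lo_pos by (intro mult_right_mono frac_le) auto
      then show "over r w i * w i \<le> 1 / rho_lo * (w i * w i)" by (simp add: over_def)
    qed
    then have "cell * (\<Sum>i\<in>J. over r w i * w i) \<le> cell * (1 / rho_lo * (\<Sum>i\<in>J. w i * w i))"
      unfolding sum_distrib_left[symmetric] by (rule mult_left_mono[OF _ less_imp_le[OF cell_pos]])
    then show ?thesis unfolding inner_h_def by (simp only: mult.left_commute)
  qed
  finally show ?thesis .
qed

text \<open>
  In terms of \<open>y = w / r\<close> the quadratic form is \<open>(r y, y) + (ht\<^sup>2 / 12) (L y, y)\<close>.  The first term is at least
  \<open>rho_lo (y, y)\<close>, and the second one is strictly larger than \<open>- rho_lo (y, y)\<close> by the stability
  condition.
\<close>

lemma positive_definite_I_rho: "positive_definite G"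
  unfolding positive_definite_def
proof (intro conjI ballI impI self_adjoint_I_rho)
  fix w assume w: "w \<in> H_space N" "w \<noteq> 0"
  define y where "y = over r w"
  have y: "y \<in> H_space N" using w by (simp add: y_def over_mem)
  have wy: "w i = r i * y i" if "i \<in> J" for i using r_pos[OF that] by (simp add: y_def over_def)
  have "y \<noteq> 0"
  proof
    assume "y = 0"
    then have "w i = 0" for i using wy[of i] w by (cases "i \<in> J") (auto simp: H_space_iff)
    then show False using w by (simp add: fun_eq_iff)
  qed
  have "rho_lo * (\<Sum>i\<in>J. y i * y i) \<le> (\<Sum>i\<in>J. y i * w i)"
    unfolding sum_distrib_left
  proof (rule sum_mono)
    fix i assume i: "i \<in> J"
    have "rho_lo * (y i * y i) \<le> r i * (y i * y i)"
      using r_ge[OF i] by (intro mult_right_mono) auto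
    then show "rho_lo * (y i * y i) \<le> y i * w i" using wy[OF i] by (simp add: mult_ac)
  qed
  then have "cell * (rho_lo * (\<Sum>i\<in>J. y i * y i)) \<le> cell * (\<Sum>i\<in>J. y i * w i)"
    by (rule mult_left_mono[OF _ less_imp_le[OF cell_pos]])
  then have 1: "rho_lo * inner_h N h y y \<le> inner_h N h y w"
    unfolding inner_h_def by (simp only: mult.left_commute)
  have "ht\<^sup>2 / 12 * (- (4 * (\<Sum>k\<in>UNIV. (a k)\<^sup>2 / (h k)\<^sup>2) * inner_h N h y y))
      < ht\<^sup>2 / 12 * inner_h N h (L_h N h a y) y"
    using L_lower[OF y \<open>y \<noteq> 0\<close>, of a] a_pos ht_pos by (intro mult_strict_left_mono) auto
  moreover have "ht\<^sup>2 / 3 * (\<Sum>k\<in>UNIV. (a k)\<^sup>2 / (h k)\<^sup>2) * inner_h N h y y \<le> rho_lo * inner_h N h y y"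
    using stable nonneg[OF y] by (rule mult_right_mono)
  moreover have "ht\<^sup>2 / 12 * (- (4 * (\<Sum>k\<in>UNIV. (a k)\<^sup>2 / (h k)\<^sup>2) * inner_h N h y y))
      = - (ht\<^sup>2 / 3 * (\<Sum>k\<in>UNIV. (a k)\<^sup>2 / (h k)\<^sup>2) * inner_h N h y y)" by simp
  ultimately show "0 < inner_h N h (G w) w"
    unfolding inner_I_rho[OF w(1)] y_def[symmetric] using 1 by linarith
qed

abbreviation Gi where "Gi \<equiv> op_inv N G"

lemmas inv_I_rho = op_inv_positive_definite[OF positive_definite_I_rho]

text \<open>
  Inversion of \<open>I_rho \<le> 1 / rho_lo\<close>, by the inequality for \<open>C\<^sup>2\<close> applied to the preimage of \<open>w\<close>.
\<close>

lemma inv_I_rho_ge: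
  assumes w: "w \<in> H_space N"
  shows "rho_lo * inner_h N h w w \<le> inner_h N h (Gi w) w"
proof -
  have "inner_h N h (G (Gi w)) (G (Gi w)) \<le> 1 / rho_lo * inner_h N h (G (Gi w)) (Gi w)"
    using positive_definite_positive[OF positive_definite_I_rho] I_rho_le inv_I_rho(3)[OF w]
    by (rule positive_bounded_sq)
  then have "inner_h N h w w \<le> 1 / rho_lo * inner_h N h (Gi w) w"
    unfolding inv_I_rho(4)[OF w] inner_h_commute[of w "Gi w"] .
  then show ?thesis using rho_lo_pos by (simp add: field_simps)
qed

end

section \<open>Reduction to the three-level scheme\<close>

context wave_grid
begin

lemma I_t_sbar:
  "I_t ht 0 (sbar_t y) = 0"
  "I_t ht (Suc m) (sbar_t y) = I_t ht m (sbar_t y) + (ht / 2) *\<^sub>R (y m + y (Suc m))"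
  by (simp_all add: I_t_def sbar_t_def fun_eq_iff algebra_simps)

text \<open>
  Solving the auxiliary equations by the inverses of \<open>s_k\<close> replaces the compact approximation of the Laplacian
  by \<open>- E_h v\<close> plus the contribution of the perturbations \<open>b\<close>, which becomes part of the data.
\<close>

lemma eliminate_compact_laplacian:
  assumes v: "v \<in> H_space N" and vkk: "\<And>k. vkk k \<in> H_space N" and b: "\<And>k. b k \<in> H_space N"
    and scheme: "\<And>k i. i \<in> J \<Longrightarrow> s_k N k (vkk k) i = Lambda_k N h k v i + b k i"
  shows "over r (rhoL N h ht a r (\<lambda>i. \<Sum>k\<in>UNIV. (a k)\<^sup>2 * vkk k i))
    = over r (rhoL N h ht a r (\<lambda>i. \<Sum>k\<in>UNIV. (a k)\<^sup>2 * op_inv N (s_k N k) (b k) i)) - G (E_h N h a v)"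
proof -
  let ?p = "\<lambda>i. \<Sum>k\<in>UNIV. (a k)\<^sup>2 * op_inv N (s_k N k) (b k) i"
  have "vkk k = sLambda k v + op_inv N (s_k N k) (b k)" for k
  proof -
    have "s_k N k (vkk k) = Lambda_k N h k v + b k"
      by (rule grid_eqI)
        (simp_all add: scheme Lambda_mem b self_adjointD(1)[OF self_adjoint_s vkk])
    then have "vkk k = op_inv N (s_k N k) (Lambda_k N h k v + b k)"
      using inv_s(5)[OF vkk] by metis
    also have "\<dots> = sLambda k v + op_inv N (s_k N k) (b k)"
      using inv_s(2) Lambda_mem b by (intro self_adjoint_linear(1)) (auto simp: positive_def)
    finally show ?thesis .
  qed
  then have "(\<lambda>i. \<Sum>k\<in>UNIV. (a k)\<^sup>2 * vkk k i) = ?p - E_h N h a v"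
    by (simp add: fun_eq_iff E_h_def sum.distrib[symmetric] distrib_left add.commute)
  moreover have "?p \<in> H_space N"
    using inv_s(3)[OF b] by (auto simp: H_space_iff intro!: sum.neutral)
  moreover have "E_h N h a v \<in> H_space N"
    using positive_E v by (auto simp: positive_def self_adjointD(1))
  ultimately show ?thesis
    unfolding I_rho_rhoL[symmetric] by (simp only: self_adjoint_linear(2)[OF self_adjoint_I_rho])
qed

end

theorem theorem1:
  fixes X :: "real ^ 'n::finite" and T :: real
    and a :: "'n \<Rightarrow> real"
    and \<rho> :: "real ^ 'n \<Rightarrow> real" and rho_lo rho_hi :: real
    and M :: nat and N :: "'n \<Rightarrow> nat"
    and ht :: real and h :: "'n \<Rightarrow> real" and r :: "'n grid"
    and v :: "nat \<Rightarrow> 'n grid" and vkk :: "'n \<Rightarrow> nat \<Rightarrow> 'n grid"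
    and f :: "nat \<Rightarrow> 'n grid" and b :: "'n \<Rightarrow> nat \<Rightarrow> 'n grid" and u1 :: "'n grid"
    and \<epsilon> \<epsilon>\<^sub>0 :: real
  assumes X_pos: "\<And>k. X $ k > 0" and T_pos: "T > 0"
    and a_pos: "\<And>k. a k > 0"
    and rho_lo_pos: "0 < rho_lo"
    and rho_bounds: "\<And>x. x \<in> closure (box 0 X) \<Longrightarrow> rho_lo \<le> \<rho> x \<and> \<rho> x \<le> rho_hi"
    and M_ge: "M \<ge> 2" and N_ge: "\<And>k. N k \<ge> 1"
    and ht_eq: "ht = T / real M"
    and h_eq: "h = (\<lambda>k. X $ k / real (N k))"
    and r_eq: "r = (\<lambda>i. \<rho> (node h i))"
    and v_in: "\<And>m. m \<le> M \<Longrightarrow> v m \<in> H_space N"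
    and vkk_in: "\<And>k m. m \<le> M - 1 \<Longrightarrow> vkk k m \<in> H_space N"
    and f_in: "\<And>m. m \<le> M - 1 \<Longrightarrow> f m \<in> H_space N"
    and b_in: "\<And>k m. m \<le> M - 1 \<Longrightarrow> b k m \<in> H_space N"
    and u1_in: "u1 \<in> H_space N"
    and scheme:
      "\<And>m i. 1 \<le> m \<Longrightarrow> m \<le> M - 1 \<Longrightarrow> i \<in> interior_nodes N \<Longrightarrow>
         r i * Lambda_t ht v m i
           - rhoL N h ht a r (\<lambda>j. \<Sum>k\<in>UNIV. (a k)\<^sup>2 * vkk k m j) i = f m i"
    and scheme_kk:
      "\<And>k m i. m \<le> M - 1 \<Longrightarrow> i \<in> interior_nodes N \<Longrightarrow>
         s_k N k (vkk k m) i = Lambda_k N h k (v m) i + b k m i"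
    and scheme_init:
      "\<And>i. i \<in> interior_nodes N \<Longrightarrow>
         r i * d_t ht v 0 i
           = ht / 2 * rhoL N h ht a r (\<lambda>j. \<Sum>k\<in>UNIV. (a k)\<^sup>2 * vkk k 0 j) i
             + u1 i + ht / 2 * f 0 i"
    and eps: "0 \<le> \<epsilon>" "\<epsilon> < 1"
    and stab1: "ht\<^sup>2 / 3 * (\<Sum>k\<in>UNIV. (a k)\<^sup>2 / (h k)\<^sup>2) \<le> (1 - \<epsilon>) * rho_lo"
    and eps0: "0 < \<epsilon>\<^sub>0" "\<epsilon>\<^sub>0 < 1"
    and stab2: "op_le N h (\<lambda>w i. ht\<^sup>2 / 4 * E_h N h a w i) (\<lambda>w i. (1 - \<epsilon>\<^sub>0\<^sup>2) * rho_lo * w i)"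
  shows
    "(MAX m\<in>{0..M}.
        max (\<epsilon>\<^sub>0 * norm_op N h (E_h N h a) (v m))
            (norm_op N h (I_rho N h ht a r) (I_t ht m (sbar_t (\<lambda>l. E_h N h a (v l))))))
      \<le> norm_op N h (E_h N h a) (v 0)
         + 2 * norm_op N h (op_inv N (I_rho N h ht a r)) (over r u1)
         + 2 * norm_L1 N h ht M (\<lambda>m. op_sqrt N h (op_inv N (I_rho N h ht a r))
                 (over r (\<lambda>i. f m i + beta_h N h ht a r b m i)))
     \<and>
     \<epsilon>\<^sub>0 * (MAX m\<in>{1..M}. norm_op N h (op_inv N (I_rho N h ht a r)) (dbar_t ht v m))
      \<le> (1 + \<epsilon>\<^sub>0) * norm_op N h (E_h N h a) (v 0)
         + (3 + 2 * \<epsilon>\<^sub>0) *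
             (norm_op N h (op_inv N (I_rho N h ht a r)) (over r u1)
              + norm_L1 N h ht M (\<lambda>m. op_sqrt N h (op_inv N (I_rho N h ht a r))
                  (over r (\<lambda>i. f m i + beta_h N h ht a r b m i))))"
proof -
  have h_pos: "0 < h k" for k
    using X_pos[of k] N_ge[of k] by (simp add: h_eq divide_pos_pos)
  have r_ge: "rho_lo \<le> r i" if "i \<in> interior_nodes N" for i
  proof -
    \<comment> \<open>interior nodes lie in the open box, where the bounds for the coefficient hold\<close>
    have "node h i \<in> box 0 X"
      unfolding mem_box_cart
    proof
      fix k
      have "1 \<le> i k" "i k < N k" using that by (auto simp: interior_nodes_def)
      then show "0 $ k < node h i $ k \<and> node h i $ k < X $ k"
        using X_pos[of k] by (simp add: node_def h_eq field_simps)
    qed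
    then show ?thesis using rho_bounds[of "node h i"] closure_subset by (auto simp: r_eq)
  qed
  have ht_pos: "0 < ht" using T_pos M_ge by (simp add: ht_eq)
  have "ht\<^sup>2 / 3 * (\<Sum>k\<in>UNIV. (a k)\<^sup>2 / (h k)\<^sup>2) \<le> rho_lo"
  proof -
    have "(1 - \<epsilon>) * rho_lo \<le> 1 * rho_lo"
      using eps rho_lo_pos by (intro mult_right_mono) auto
    then show ?thesis using stab1 by linarith
  qed
  then interpret wave_grid N h a r ht rho_lo
    using h_pos a_pos rho_lo_pos ht_pos r_ge by unfold_locales auto
  let ?E = "E_h N h a"
  let ?F = "\<lambda>m. over r (\<lambda>i. f m i + beta_h N h ht a r b m i)"
  have elim: "over r (rhoL N h ht a r (\<lambda>i. \<Sum>k\<in>UNIV. (a k)\<^sup>2 * vkk k m i))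
      = over r (beta_h N h ht a r b m) - G (?E (v m))" if "m \<le> M - 1" for m
    unfolding beta_h_def
    by (rule eliminate_compact_laplacian) (use that v_in vkk_in b_in scheme_kk in auto)
  have F_eq: "?F m = over r (f m) + over r (beta_h N h ht a r b m)" for m
    by (simp add: over_def fun_eq_iff add_divide_distrib)
  have E_mem: "?E w \<in> H_space N" if "w \<in> H_space N" for w
    using positive_E that by (auto simp: positive_def self_adjointD(1))
  have G_mem: "G w \<in> H_space N" if "w \<in> H_space N" for w
    using self_adjoint_I_rho that by (rule self_adjointD(1))
  have F_mem: "?F m \<in> H_space N" if "m < M" for m
  proof -
    have "(\<lambda>i. \<Sum>k\<in>UNIV. (a k)\<^sup>2 * op_inv N (s_k N k) (b k m) i) \<in> H_space N"
      using inv_s(3)[OF b_in[of m]] that by (auto simp: H_space_iff intro!: sum.neutral)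
    then have "over r (beta_h N h ht a r b m) \<in> H_space N"
      unfolding beta_h_def I_rho_rhoL[symmetric] by (rule G_mem)
    then show ?thesis unfolding F_eq using f_in[of m] that by (simp add: over_mem)
  qed
  interpret S: three_level_scheme "H_space N" "inner_h N h" ?E G Gi ht \<epsilon>\<^sub>0 v ?F "over r u1" M
  proof
    show "positive ?E" by (rule positive_E)
    show "positive G" by (rule positive_definite_positive[OF positive_definite_I_rho])
    show "Gi x \<in> H_space N" "G (Gi x) = x" "Gi (G x) = x" if "x \<in> H_space N" for x
      using that by (simp_all add: inv_I_rho)
    show "0 < ht" "0 < \<epsilon>\<^sub>0" "\<epsilon>\<^sub>0 < 1" "0 < M" using ht_pos eps0 M_ge by auto
    show "ht\<^sup>2 / 4 * inner_h N h (?E x) x \<le> (1 - \<epsilon>\<^sub>0\<^sup>2) * inner_h N h (Gi x) x"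
      if x: "x \<in> H_space N" for x
    proof -
      have "inner_h N h (\<lambda>i. ht\<^sup>2 / 4 * ?E x i) x \<le> inner_h N h (\<lambda>i. (1 - \<epsilon>\<^sub>0\<^sup>2) * rho_lo * x i) x"
        using stab2 x by (simp add: op_le_def)
      then have "ht\<^sup>2 / 4 * inner_h N h (?E x) x \<le> (1 - \<epsilon>\<^sub>0\<^sup>2) * (rho_lo * inner_h N h x x)"
        using scale_left[OF E_mem[OF x] x, of "ht\<^sup>2 / 4"]
          scale_left[OF x x, of "(1 - \<epsilon>\<^sub>0\<^sup>2) * rho_lo"] by (simp add: scaleR_fun_def)
      also have "\<dots> \<le> (1 - \<epsilon>\<^sub>0\<^sup>2) * inner_h N h (Gi x) x"
        using inv_I_rho_ge[OF x] eps0 by (intro mult_left_mono) (auto simp: power_le_one)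
      finally show ?thesis .
    qed
    show "v m \<in> H_space N" if "m \<le> M" for m using v_in that .
    show "?F m \<in> H_space N" if "m < M" for m using F_mem that .
    show "over r u1 \<in> H_space N" using u1_in by (rule over_mem)
    have F0: "?F 0 \<in> H_space N" using F_mem M_ge by simp
    have v01: "v 0 \<in> H_space N" "v 1 \<in> H_space N" using v_in M_ge by auto
    show "v 1 - v 0 = ht *\<^sub>R (over r u1 + (ht / 2) *\<^sub>R (?F 0 - G (?E (v 0))))"
    proof (rule grid_eqI)
      fix i assume i: "i \<in> J"
      have "(v 1 i - v 0 i) / ht = over r u1 i
          + ht / 2 * (over r (f 0) i + over r (rhoL N h ht a r (\<lambda>i. \<Sum>k\<in>UNIV. (a k)\<^sup>2 * vkk k 0 i)) i)"
        using scheme_init[OF i] r_pos[OF i] by (simp add: over_def d_t_def field_simps)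
      also have "\<dots> = over r u1 i + ht / 2 * (?F 0 - G (?E (v 0))) i"
        using elim[of 0] by (simp add: F_eq)
      finally show "(v 1 - v 0) i = (ht *\<^sub>R (over r u1 + (ht / 2) *\<^sub>R (?F 0 - G (?E (v 0))))) i"
        using ht_pos by (simp add: divide_eq_eq mult.commute)
    qed (use v01 F0 u1_in in \<open>simp_all add: over_mem E_mem G_mem\<close>)
    show "v (Suc m) - v m = v m - v (m - 1) + ht\<^sup>2 *\<^sub>R (?F m - G (?E (v m)))"
      if m: "1 \<le> m" "m < M" for m
    proof (rule grid_eqI)
      have "v (Suc m) \<in> H_space N" "v m \<in> H_space N" "v (m - 1) \<in> H_space N" using m v_in by auto
      then show "v (Suc m) - v m \<in> H_space N"
        "v m - v (m - 1) + ht\<^sup>2 *\<^sub>R (?F m - G (?E (v m))) \<in> H_space N"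
        using F_mem[OF m(2)] by (simp_all add: E_mem G_mem)
      fix i assume i: "i \<in> J"
      have "(v (Suc m) i - 2 * v m i + v (m - 1) i) / ht\<^sup>2
          = over r (f m) i + over r (rhoL N h ht a r (\<lambda>i. \<Sum>k\<in>UNIV. (a k)\<^sup>2 * vkk k m i)) i"
        using scheme[OF m(1) _ i] m(2) r_pos[OF i] by (simp add: over_def Lambda_t_def field_simps)
      also have "\<dots> = (?F m - G (?E (v m))) i" using elim[of m] m by (simp add: F_eq)
      finally have "v (Suc m) i - 2 * v m i + v (m - 1) i = (?F m - G (?E (v m))) i * ht\<^sup>2"
        by (subst (asm) nonzero_divide_eq_eq) (use ht_pos in simp_all)
      then show "(v (Suc m) - v m) i = (v m - v (m - 1) + ht\<^sup>2 *\<^sub>R (?F m - G (?E (v m)))) i"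
        by (simp add: algebra_simps)
    qed
  qed
  let ?v0 = "norm_op N h ?E (v 0)" and ?u = "norm_op N h Gi (over r u1)"
  let ?L = "norm_L1 N h ht M (\<lambda>m. op_sqrt N h Gi (?F m))"
  have e: "S.e.nrm x = norm_op N h ?E x" and g: "S.g.nrm x = norm_op N h G x" for x
    by (simp_all add: S.e.nrm_def S.g.nrm_def norm_op_def)
  have F_norm: "norm_h N h (op_sqrt N h Gi (?F m)) = sqrt (inner_h N h (Gi (?F m)) (?F m))" if "m < M" for m
    using inv_I_rho(2) F_mem[OF that] by (rule norm_op_sqrt)
  have load: "S.load (M - 1) = ?u + ?L"
  proof -
    have "(\<Sum>m=1..M - 1. norm_h N h (op_sqrt N h Gi (?F m)))
        = (\<Sum>m=1..M - 1. sqrt (inner_h N h (Gi (?F m)) (?F m)))"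
      using M_ge by (intro sum.cong refl F_norm) auto
    then show ?thesis
      unfolding S.load_def norm_L1_def norm_op_def using F_norm[of 0] M_ge by simp
  qed
  have load_nonneg: "0 \<le> ?u + ?L" unfolding load[symmetric] using M_ge by (intro S.load_nonneg) simp
  have w: "S.w m = I_t ht m (sbar_t (\<lambda>l. ?E (v l)))" for m
    by (induction m) (simp_all add: I_t_sbar)
  show ?thesis
  proof (intro conjI)
    have "max (\<epsilon>\<^sub>0 * norm_op N h ?E (v m)) (norm_op N h G (I_t ht m (sbar_t (\<lambda>l. ?E (v l)))))
        \<le> ?v0 + 2 * ?u + 2 * ?L" if "m \<le> M" for m
      using S.e_bound[OF that] S.w_bound[OF that] load_nonneg unfolding e g load w by simp
    then show "(MAX m\<in>{0..M}. max (\<epsilon>\<^sub>0 * norm_op N h ?E (v m))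
        (norm_op N h G (I_t ht m (sbar_t (\<lambda>l. ?E (v l)))))) \<le> ?v0 + 2 * ?u + 2 * ?L"
      by (intro Max.boundedI) auto
    let ?d = "\<lambda>m. norm_op N h Gi (dbar_t ht v m)"
    \<comment> \<open>the level at which the difference quotient is largest\<close>
    have "Max (?d ` {1..M}) \<in> ?d ` {1..M}" using M_ge by (intro Max_in) auto
    then obtain m where m: "1 \<le> m" "m \<le> M" "Max (?d ` {1..M}) = ?d m" by auto
    have dbar: "dbar_t ht v m = (1 / ht) *\<^sub>R (v (Suc (m - 1)) - v (m - 1))"
      using m by (simp add: dbar_t_def fun_eq_iff)
    have "\<epsilon>\<^sub>0 * ?d m \<le> (1 + \<epsilon>\<^sub>0) * (?v0 + (?u + ?L))"
      using S.increment_bound[of "m - 1"] m unfolding dbar norm_op_def[of _ _ Gi] load e by simp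
    also have "\<dots> \<le> (1 + \<epsilon>\<^sub>0) * ?v0 + (3 + 2 * \<epsilon>\<^sub>0) * (?u + ?L)"
      using mult_right_mono[OF _ load_nonneg, of "1 + \<epsilon>\<^sub>0" "3 + 2 * \<epsilon>\<^sub>0"] eps0
      by (simp add: distrib_left)
    finally show "\<epsilon>\<^sub>0 * Max (?d ` {1..M}) \<le> (1 + \<epsilon>\<^sub>0) * ?v0 + (3 + 2 * \<epsilon>\<^sub>0) * (?u + ?L)"
      unfolding m(3) .
  qed
qed

end
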